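(* Let $\hat{\mathbf{a}}\in\mathbb{R}^{p-1}$, $\mathbf{b}\in\mathbb{R}^p$ be positive vectors (all components positive). Set $\mathbf{a}=(\hat{\mathbf{a}},1/2)$ and assume that $v_{\mathbf{a},\mathbf{b}}(t)=\sum_{j=1}^p(t^{a_j}-t^{b_j})\ge0$ on $[0,1]$ (in particular, $\mathbf{b}\prec^W\mathbf{a}$ is sufficient). Then all zeros of $$f(z)={}_{p-1}F_p\!\left(\begin{matrix}\hat{\mathbf{a}}\\\mathbf{b}\end{matrix}\,\Big|-\frac{z^2}{4}\right)-\cos(z)$$ are real and simple. Each interval $(\pi,2\pi)$, $(2\pi,3\pi)$, $\dots$ contains exactly one zero of $f$ and there are no other zeros except the trivial one at $z=0$.
   Context: ${}_{p-1}F_p$ is the generalized hypergeometric function with upper parameters $\hat{\mathbf{a}}$ and lower parameters $\mathbf{b}$. The relation $\mathbf{b}\prec^W\mathbf{a}$ (weak supermajorization) means that, with the components arranged in ascending order, $0<a_1\le a_2\le\cdots\le a_p$, $0<b_1\le b_2\le\cdots\le b_p$, and $\sum_{i=1}^ka_i\le\sum_{i=1}^kb_i$ for $k=1,\dots,p$.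
   Formalization: The case where b is a permutation of a (then f is identically zero) is excluded; simplicity is claimed only for zeros z ≠ 0, since z = 0 is a multiple zero of the even function f; and "no other zeros" is understood up to the sign change z to -z. *)

theory Defs
  imports "HOL-Complex_Analysis.Complex_Analysis" "HOL-Library.Multiset"
begin

(* The library formal series fps_hypergeo as bs c has n-th coefficient
   prod (a)_n * c^n / (prod (b)_n * n!), so c = 1 gives the usual normalisation. *)
definition hypergeo :: "complex list \<Rightarrow> complex list \<Rightarrow> complex \<Rightarrow> complex" where
  "hypergeo as bs z = eval_fps (fps_hypergeo as bs 1) z"

(* Used for lists of equal length and positive entries; then 0 powr x = 0 makes
   the value at t = 0 the intended one. *)
definition v_fun :: "real list \<Rightarrow> real list \<Rightarrow> real \<Rightarrow> real" where
  "v_fun as bs t = (\<Sum>j<length as. t powr (as ! j) - t powr (bs ! j))"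

(* weak_supermajorized bs as reads "bs is weakly supermajorized by as". *)
definition weak_supermajorized :: "real list \<Rightarrow> real list \<Rightarrow> bool" where
  "weak_supermajorized bs as \<longleftrightarrow>
     length bs = length as \<and> (\<forall>x\<in>set as. 0 < x) \<and> (\<forall>x\<in>set bs. 0 < x) \<and>
     (\<forall>k\<in>{1..length as}. (\<Sum>i<k. sort as ! i) \<le> (\<Sum>i<k. sort bs ! i))"

definition hypergeo_minus_cos :: "real list \<Rightarrow> real list \<Rightarrow> complex \<Rightarrow> complex" where
  "hypergeo_minus_cos as bs z =
     hypergeo (map of_real as) (map of_real bs) (- (z\<^sup>2 / 4)) - cos z"

end

theory Submission
  imports Defs
begin

text \<open>Put m_n = \<Prod>i. (a_i)_n / (b_i)_n, where the upper parameter 1/2 is included.  Since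
(1/2)_n * n! * 4^n = (2n)!, the hypergeometric function is \<Sum>n. m_n (-z^2)^n / (2n)!, and with all
m_n replaced by 1 this series is cos z.  The sign condition on v makes the m_n the moments of a
probability measure \<mu> on [0,1], so that the function is the average G(z) of cos (z * sqrt t) over t
distributed according to \<mu>.

Averaging makes G smaller in modulus than the cosine on the lines Re z = k\<pi> with k \<noteq> 0: there
|cos z| = cosh (Im z), while |G(z)| is at most the average of cosh (sqrt t * Im z).  The same
comparison holds on horizontal lines far from the real axis.  The theorem of Rouche on rectangles
with these sides then gives G - cos as many zeros as cos: one between k\<pi> and (k+1)\<pi> for
k \<noteq> 0, -1, and two in the strip |Re z| < \<pi>.  A zero which is alone in its strip equals its complex
conjugate, so it is real and simple.  In the central strip a zero z \<noteq> 0 would bring -z and 0 with it,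
three zeros instead of two.

The comparison is strict on the whole line only if |G(k\<pi>)| < 1, which fails only when \<mu> lives on
finitely many points of the form (j/k)^2.  In that case m_n - m_(n+1) would decay geometrically.
But m_(n+1) / m_n is a rational function of n with limit 1, and it is not the constant 1 unless the
two parameter lists are rearrangements of each other; so the decay is slower than every geometric
sequence (\<open>pochhammer_ratio_not_geometric\<close>).

That the m_n are moments follows from an expansion with a base 0 < q < 1.  Replacing every factor a + k by
1 - q^(a+k) and expanding the logarithm gives

  \<Prod>k<n. \<Prod>i. (1 - q^(a_i+k)) / (1 - q^(b_i+k))  =  exp (- (\<Sum>j\<ge>1. w_j * (1 - (q^j)^n)))
  with  w_j = v(q^j) / (j * (1 - q^j)),

a product of moment sequences of Poisson type because v \<ge> 0; then q tends to 1
(\<open>moment_positive_pochhammer_ratio\<close>).  The measure itself is never constructed: all that is used is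
that the linear functional with t^n \<mapsto> m_n is nonnegative on polynomials which are nonnegative on [0,1].\<close>

section \<open>Moment sequences on the unit interval\<close>

text \<open>The functional which sends t^n to s_n is nonnegative on the polynomials that are nonnegative on
the unit interval.  By the theorem of Riesz these are the moment sequences of the finite measures on [0,1];
in this form the property is closed under pointwise limits without any compactness argument.\<close>
definition moment_positive :: "(nat \<Rightarrow> real) \<Rightarrow> bool" where
  "moment_positive s \<longleftrightarrow>
     (\<forall>N c. (\<forall>t\<in>{0..1}. 0 \<le> (\<Sum>n\<le>N. c n * t ^ n)) \<longrightarrow> 0 \<le> (\<Sum>n\<le>N. c n * s n))"

lemma moment_positiveD:
  assumes "moment_positive s" "\<And>t. 0 \<le> t \<Longrightarrow> t \<le> 1 \<Longrightarrow> 0 \<le> (\<Sum>n\<le>N. c n * t ^ n)"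
  shows "0 \<le> (\<Sum>n\<le>N. c n * s n)"
  using assms unfolding moment_positive_def by auto

lemma moment_positive_const_1: "moment_positive (\<lambda>_. 1)"
  unfolding moment_positive_def
proof (intro allI impI)
  fix N and c :: "nat \<Rightarrow> real"
  assume "\<forall>t\<in>{0..1}. 0 \<le> (\<Sum>n\<le>N. c n * t ^ n)"
  from bspec[OF this, of 1] show "0 \<le> (\<Sum>n\<le>N. c n * 1)" by simp
qed

text \<open>Multiplication by \<tau>^n is the dilation t \<mapsto> \<tau> t of the measure, and it maps the unit interval
into itself.\<close>
lemma moment_positive_power_mult:
  assumes "moment_positive s" "0 \<le> \<tau>" "\<tau> \<le> 1"
  shows "moment_positive (\<lambda>n. \<tau> ^ n * s n)"
  unfolding moment_positive_def
proof (intro allI impI)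
  fix N and c :: "nat \<Rightarrow> real"
  assume c: "\<forall>t\<in>{0..1}. 0 \<le> (\<Sum>n\<le>N. c n * t ^ n)"
  have "0 \<le> (\<Sum>n\<le>N. (c n * \<tau> ^ n) * s n)"
  proof (rule moment_positiveD[OF assms(1)])
    fix t :: real assume "0 \<le> t" "t \<le> 1"
    then have "\<tau> * t \<in> {0..1}" using assms by (simp add: mult_le_one)
    then show "0 \<le> (\<Sum>n\<le>N. (c n * \<tau> ^ n) * t ^ n)"
      using c[rule_format, of "\<tau> * t"] by (simp add: power_mult_distrib mult.assoc)
  qed
  then show "0 \<le> (\<Sum>n\<le>N. c n * (\<tau> ^ n * s n))"
    by (simp add: mult.assoc)
qed

lemma moment_positive_cmult:
  assumes "moment_positive s" "0 \<le> a"
  shows "moment_positive (\<lambda>n. a * s n)"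
  unfolding moment_positive_def
proof (intro allI impI)
  fix N and c :: "nat \<Rightarrow> real"
  assume "\<forall>t\<in>{0..1}. 0 \<le> (\<Sum>n\<le>N. c n * t ^ n)"
  then have "0 \<le> a * (\<Sum>n\<le>N. c n * s n)"
    using assms by (auto simp: moment_positive_def)
  then show "0 \<le> (\<Sum>n\<le>N. c n * (a * s n))"
    by (simp add: sum_distrib_left algebra_simps)
qed

lemma moment_positive_sum:
  assumes "\<And>k. k \<in> A \<Longrightarrow> moment_positive (s k)"
  shows "moment_positive (\<lambda>n. \<Sum>k\<in>A. s k n)"
  unfolding moment_positive_def
proof (intro allI impI)
  fix N and c :: "nat \<Rightarrow> real"
  assume "\<forall>t\<in>{0..1}. 0 \<le> (\<Sum>n\<le>N. c n * t ^ n)"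
  then have "0 \<le> (\<Sum>k\<in>A. \<Sum>n\<le>N. c n * s k n)"
    using assms by (intro sum_nonneg[of A]) (simp add: moment_positive_def)
  also have "\<dots> = (\<Sum>n\<le>N. c n * (\<Sum>k\<in>A. s k n))"
    by (subst sum.swap) (simp add: sum_distrib_left)
  finally show "0 \<le> (\<Sum>n\<le>N. c n * (\<Sum>k\<in>A. s k n))" .
qed

lemma moment_positive_LIMSEQ:
  assumes "\<And>k. moment_positive (s k)" "\<And>n. (\<lambda>k. s k n) \<longlonglongrightarrow> r n"
  shows "moment_positive r"
  unfolding moment_positive_def
proof (intro allI impI)
  fix N and c :: "nat \<Rightarrow> real"
  assume c: "\<forall>t\<in>{0..1}. 0 \<le> (\<Sum>n\<le>N. c n * t ^ n)"
  have "(\<lambda>k. \<Sum>n\<le>N. c n * s k n) \<longlonglongrightarrow> (\<Sum>n\<le>N. c n * r n)"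
    by (intro tendsto_intros assms)
  then show "0 \<le> (\<Sum>n\<le>N. c n * r n)"
    by (rule tendsto_lowerbound)
       (use c assms in \<open>auto simp: moment_positive_def\<close>)
qed

text \<open>The factor exp (-\<mu> * (1 - \<tau>^n)) is the n-th moment of \<tau>^K for a Poisson variable K of mean
\<mu>; the exponential series writes the product as a mixture of dilations by \<tau>^k.\<close>
lemma moment_positive_poisson_mult:
  assumes "moment_positive s" "0 \<le> \<tau>" "\<tau> \<le> 1" "0 \<le> \<mu>"
  shows "moment_positive (\<lambda>n. exp (- \<mu> * (1 - \<tau> ^ n)) * s n)"
proof (rule moment_positive_LIMSEQ)
  show "moment_positive (\<lambda>n. \<Sum>k<K. (exp (- \<mu>) * (\<mu> ^ k / fact k)) * ((\<tau> ^ k) ^ n * s n))" for K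
    using assms
    by (intro moment_positive_sum moment_positive_cmult moment_positive_power_mult)
       (auto simp: power_le_one)
  fix n
  have "(\<lambda>k. (\<mu> * \<tau> ^ n) ^ k / fact k) sums exp (\<mu> * \<tau> ^ n)"
    using exp_converges[of "\<mu> * \<tau> ^ n"] by (simp add: divide_inverse mult.commute)
  then have "(\<lambda>k. exp (- \<mu>) * s n * ((\<mu> * \<tau> ^ n) ^ k / fact k))
               sums (exp (- \<mu>) * s n * exp (\<mu> * \<tau> ^ n))"
    by (rule sums_mult)
  also have "exp (- \<mu>) * s n * exp (\<mu> * \<tau> ^ n) = exp (- \<mu> * (1 - \<tau> ^ n)) * s n"
    by (simp add: algebra_simps exp_diff exp_minus divide_simps)
  also have "(\<lambda>k. exp (- \<mu>) * s n * ((\<mu> * \<tau> ^ n) ^ k / fact k)) =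
      (\<lambda>k. exp (- \<mu>) * (\<mu> ^ k / fact k) * ((\<tau> ^ k) ^ n * s n))"
    by (simp add: power_mult_distrib power_mult[symmetric] mult.commute[of n] fun_eq_iff)
  finally show "(\<lambda>K. \<Sum>k<K. (exp (- \<mu>) * (\<mu> ^ k / fact k)) * ((\<tau> ^ k) ^ n * s n))
      \<longlonglongrightarrow> exp (- \<mu> * (1 - \<tau> ^ n)) * s n"
    by (simp add: sums_def)
qed

lemma moment_positive_exp_sum:
  fixes \<tau> \<mu> :: "nat \<Rightarrow> real"
  assumes "\<And>j. j < J \<Longrightarrow> 0 \<le> \<tau> j \<and> \<tau> j \<le> 1 \<and> 0 \<le> \<mu> j"
  shows "moment_positive (\<lambda>n. exp (- (\<Sum>j<J. \<mu> j * (1 - \<tau> j ^ n))))"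
  using assms
proof (induction J)
  case 0
  then show ?case by (simp add: moment_positive_const_1)
next
  case (Suc J)
  have "moment_positive (\<lambda>n. exp (- \<mu> J * (1 - \<tau> J ^ n)) * exp (- (\<Sum>j<J. \<mu> j * (1 - \<tau> j ^ n))))"
    using Suc by (intro moment_positive_poisson_mult) auto
  then show ?case by (simp add: algebra_simps flip: exp_add)
qed

lemma sum_if_eq_mult:
  fixes g :: "nat \<Rightarrow> real"
  shows "(\<Sum>k\<le>n. (if k = m then b else 0) * g k) = (if m \<le> n then b * g m else 0)"
proof -
  have "(\<Sum>k\<le>n. (if k = m then b else 0) * g k) = (\<Sum>k\<le>n. if k = m then b * g k else 0)"
    by (rule sum.cong[OF refl]) simp
  also have "\<dots> = (if m \<le> n then b * g m else 0)"
    by (subst sum.delta) auto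
  finally show ?thesis .
qed

text \<open>Positivity passes from polynomials to absolutely convergent power series: cutting the series after
N terms changes it on the unit interval by at most the tail r_N of the coefficients, and the
polynomial raised by the constant r_N is nonnegative.\<close>
lemma moment_positive_suminf:
  assumes s: "moment_positive s" and c: "summable (\<lambda>n. \<bar>c n\<bar>)"
    and sum: "summable (\<lambda>n. c n * s n)"
    and nonneg: "\<And>t. 0 \<le> t \<Longrightarrow> t \<le> 1 \<Longrightarrow> 0 \<le> (\<Sum>n. c n * t ^ n)"
  shows "0 \<le> (\<Sum>n. c n * s n)"
proof -
  define r where "r N = (\<Sum>n. \<bar>c (n + Suc N)\<bar>)" for N
  have r_lim: "r \<longlonglongrightarrow> 0"
    unfolding r_def[abs_def] by (rule LIMSEQ_Suc[OF suminf_exist_split2[OF c, unfolded real_norm_def abs_abs]])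
  have partial: "0 \<le> (\<Sum>n\<le>N. c n * s n) + r N * s 0" for N
  proof -
    have "0 \<le> (\<Sum>n\<le>N. (c n + (if n = 0 then r N else 0)) * s n)"
    proof (rule moment_positiveD[OF s])
      fix t :: real assume t: "0 \<le> t" "t \<le> 1"
      have bound: "norm (c n * t ^ n) \<le> \<bar>c n\<bar>" for n
        using t mult_left_le[of "t ^ n" "\<bar>c n\<bar>"] by (simp add: abs_mult power_le_one)
      have sumt: "summable (\<lambda>n. c n * t ^ n)"
        by (rule summable_comparison_test'[OF c bound])
      have sumc: "summable (\<lambda>n. \<bar>c (n + Suc N)\<bar>)"
        by (rule summable_ignore_initial_segment[OF c])
      have "(\<Sum>n. c n * t ^ n) = (\<Sum>n. c (n + Suc N) * t ^ (n + Suc N)) + (\<Sum>n<Suc N. c n * t ^ n)"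
        by (rule suminf_split_initial_segment[OF sumt])
      moreover have "(\<Sum>n. c (n + Suc N) * t ^ (n + Suc N)) \<le> r N"
        unfolding r_def
      proof (rule suminf_le[OF _ summable_ignore_initial_segment[OF sumt] sumc])
        show "c (n + Suc N) * t ^ (n + Suc N) \<le> \<bar>c (n + Suc N)\<bar>" for n
          by (rule order_trans[OF _ bound]) simp
      qed
      moreover have "(\<Sum>n\<le>N. (c n + (if n = 0 then r N else 0)) * t ^ n) = (\<Sum>n\<le>N. c n * t ^ n) + r N"
        by (simp add: distrib_right sum.distrib sum_if_eq_mult)
      ultimately show "0 \<le> (\<Sum>n\<le>N. (c n + (if n = 0 then r N else 0)) * t ^ n)"
        using nonneg[OF t] unfolding lessThan_Suc_atMost by linarith
    qed
    then show ?thesis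
      by (simp add: distrib_right sum.distrib sum_if_eq_mult)
  qed
  have lim: "(\<lambda>N. (\<Sum>n\<le>N. c n * s n) + r N * s 0) \<longlonglongrightarrow> (\<Sum>n. c n * s n) + 0 * s 0"
    by (rule tendsto_add[OF summable_LIMSEQ'[OF sum] tendsto_mult[OF r_lim tendsto_const]])
  have "0 \<le> (\<Sum>n. c n * s n) + 0 * s 0"
    by (rule LIMSEQ_le_const[OF lim]) (use partial in blast)
  then show ?thesis by simp
qed

lemma moment_positive_antimono:
  assumes "moment_positive s" "m \<le> n"
  shows "s n \<le> s m"
proof -
  have "0 \<le> (\<Sum>k\<le>n. ((if k = m then 1 else 0) - (if k = n then 1 else 0)) * s k)"
    using assms(2)
    by (intro moment_positiveD[OF assms(1)])
       (auto simp: left_diff_distrib sum_subtractf sum_if_eq_mult power_decreasing)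
  then show ?thesis using assms(2)
    by (simp add: left_diff_distrib sum_subtractf sum_if_eq_mult)
qed

lemma moment_positive_nonneg:
  assumes "moment_positive s"
  shows "0 \<le> s n"
proof -
  have "0 \<le> (\<Sum>k\<le>n. (if k = n then 1 else 0) * s k)"
    by (intro moment_positiveD[OF assms]) (auto simp: sum_if_eq_mult)
  then show ?thesis
    by (simp add: sum_if_eq_mult)
qed

lemma moment_positive_abs_le_1:
  assumes "moment_positive s" "s 0 = 1"
  shows "\<bar>s n\<bar> \<le> 1"
  using moment_positive_nonneg[OF assms(1), of n] moment_positive_antimono[OF assms(1), of 0 n] assms(2)
  by simp

text \<open>Integrated form of t^n (1 - t) \<le> 1 - t.\<close>
lemma moment_positive_diff_le:
  assumes "moment_positive s"
  shows "s n - s (Suc n) \<le> s 0 - s 1"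
proof -
  let ?c = "\<lambda>k. (if k = 0 then 1 else 0) - (if k = 1 then 1 else 0)
     - (if k = n then 1 else 0) + (if k = Suc n then 1 else (0::real))"
  have eq: "(\<Sum>k\<le>Suc n. ?c k * g k) = g 0 - g 1 - g n + g (Suc n)" for g
    unfolding left_diff_distrib distrib_right sum.distrib sum_subtractf sum_if_eq_mult by simp
  have "0 \<le> (\<Sum>k\<le>Suc n. ?c k * s k)"
  proof (rule moment_positiveD[OF assms])
    fix t :: real assume t: "0 \<le> t" "t \<le> 1"
    have "0 \<le> (1 - t) * (1 - t ^ n)"
      using t by (intro mult_nonneg_nonneg) (auto simp: power_le_one)
    then show "0 \<le> (\<Sum>k\<le>Suc n. ?c k * t ^ k)"
      unfolding eq by (simp add: algebra_simps)
  qed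
  then show ?thesis unfolding eq by simp
qed

section \<open>Pochhammer quotients are moments\<close>

definition pochhammer_ratio :: "real list \<Rightarrow> real list \<Rightarrow> nat \<Rightarrow> real" where
  "pochhammer_ratio as bs n =
     (\<Prod>i<length as. pochhammer (as ! i) n / pochhammer (bs ! i) n)"

text \<open>The q-analogue, in which the number x is replaced by 1 - q^x.  The normalising factors
1/(1-q) cancel because both parameter lists have the same length.\<close>
definition q_pochhammer_ratio :: "real \<Rightarrow> real list \<Rightarrow> real list \<Rightarrow> nat \<Rightarrow> real" where
  "q_pochhammer_ratio q as bs n =
     (\<Prod>i<length as. \<Prod>k<n. (1 - q powr (as ! i + real k)) / (1 - q powr (bs ! i + real k)))"

lemma ln_one_minus_sums:
  fixes x :: real
  assumes "0 \<le> x" "x < 1"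
  shows "(\<lambda>j. x ^ j / of_nat j) sums (- ln (1 - x))"
  using sums_minus[OF ln_series'[of "-x"]] assms by simp

lemma powr_lt_1:
  fixes q x :: real
  assumes "0 < q" "q < 1" "0 < x"
  shows "q powr x < 1"
  using powr_less_mono'[of q 0 x] assms by simp

text \<open>Each -ln(1 - q^(x+k)) expands into \<Sum>j. (q^j)^(x+k)/j.  The sum over the parameters then
produces v(q^j), and the geometric sum over k < n produces (1 - q^(jn))/(1 - q^j).  The term
j = 0 vanishes on both sides since division by 0 yields 0.\<close>
lemma ln_q_pochhammer_ratio_sums:
  assumes q: "0 < q" "q < 1"
    and pos: "\<And>i. i < length as \<Longrightarrow> 0 < as ! i" "\<And>i. i < length as \<Longrightarrow> 0 < bs ! i"
  shows "(\<lambda>j. v_fun as bs (q ^ j) / (real j * (1 - q ^ j)) * (1 - (q ^ j) ^ n))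
           sums (- ln (q_pochhammer_ratio q as bs n))"
proof -
  have lt1: "q powr (as ! i + real k) < 1" "q powr (bs ! i + real k) < 1"
    if "i < length as" for i k
    using pos[OF that] q by (auto intro!: powr_lt_1)
  have "(\<lambda>j. \<Sum>i<length as. \<Sum>k<n. (q powr (as ! i + real k)) ^ j / of_nat j - (q powr (bs ! i + real k)) ^ j / of_nat j)
     sums (\<Sum>i<length as. \<Sum>k<n. - ln (1 - q powr (as ! i + real k)) - (- ln (1 - q powr (bs ! i + real k))))"
    by (intro sums_sum sums_diff ln_one_minus_sums) (use lt1 in auto)
  also have "(\<lambda>j. \<Sum>i<length as. \<Sum>k<n. (q powr (as ! i + real k)) ^ j / of_nat j - (q powr (bs ! i + real k)) ^ j / of_nat j)
     = (\<lambda>j. v_fun as bs (q ^ j) / (real j * (1 - q ^ j)) * (1 - (q ^ j) ^ n))"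
  proof
    fix j
    show "(\<Sum>i<length as. \<Sum>k<n. (q powr (as ! i + real k)) ^ j / of_nat j - (q powr (bs ! i + real k)) ^ j / of_nat j)
        = v_fun as bs (q ^ j) / (real j * (1 - q ^ j)) * (1 - (q ^ j) ^ n)"
    proof (cases "j = 0")
      case False
      define r where "r = q ^ j"
      have r: "0 < r" "r < 1" using q False by (auto simp: r_def power_Suc_less_one power_less_one_iff)
      have pw: "(q powr (x + real k)) ^ j = r powr x * r ^ k" for x k
      proof -
        have "(q powr (x + real k)) ^ j = (q powr (x + real k)) powr real j"
          using q by (simp add: powr_realpow)
        also have "\<dots> = (q powr real j) powr (x + real k)"
          by (simp add: powr_powr mult.commute)
        also have "\<dots> = r powr x * r ^ k"
          using q r by (simp add: powr_realpow r_def powr_add)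
        finally show ?thesis .
      qed
      have "(\<Sum>i<length as. \<Sum>k<n. (q powr (as ! i + real k)) ^ j / of_nat j - (q powr (bs ! i + real k)) ^ j / of_nat j)
          = (\<Sum>i<length as. \<Sum>k<n. (r powr (as ! i) - r powr (bs ! i)) / j * r ^ k)"
        by (simp add: pw diff_divide_distrib left_diff_distrib)
      also have "\<dots> = v_fun as bs r / j * (\<Sum>k<n. r ^ k)"
        by (simp add: v_fun_def sum_distrib_left[symmetric] sum_distrib_right[symmetric] sum_divide_distrib[symmetric])
      also have "(\<Sum>k<n. r ^ k) = (1 - r ^ n) / (1 - r)"
        using r by (simp add: sum_gp_strict)
      finally show ?thesis by (simp add: r_def)
    qed simp
  qed
  also have "(\<Sum>i<length as. \<Sum>k<n. - ln (1 - q powr (as ! i + real k)) - (- ln (1 - q powr (bs ! i + real k))))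
      = - (\<Sum>i<length as. \<Sum>k<n. ln ((1 - q powr (as ! i + real k)) / (1 - q powr (bs ! i + real k))))"
  proof -
    have "- ln (1 - q powr (as ! i + real k)) - (- ln (1 - q powr (bs ! i + real k))) =
        - ln ((1 - q powr (as ! i + real k)) / (1 - q powr (bs ! i + real k)))" if "i < length as" for i k
      using lt1[OF that, of k] by (subst ln_div) auto
    then show ?thesis by (simp add: sum_negf[symmetric])
  qed
  also have "(\<Sum>i<length as. \<Sum>k<n. ln ((1 - q powr (as ! i + real k)) / (1 - q powr (bs ! i + real k))))
      = ln (q_pochhammer_ratio q as bs n)"
  proof -
    have fac: "0 < (1 - q powr (as ! i + real k)) / (1 - q powr (bs ! i + real k))" if "i < length as" for i k
      using lt1[OF that] by simp
    have inner: "ln (\<Prod>k<n. (1 - q powr (as ! i + real k)) / (1 - q powr (bs ! i + real k)))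
        = (\<Sum>k<n. ln ((1 - q powr (as ! i + real k)) / (1 - q powr (bs ! i + real k))))"
      if "i < length as" for i
      by (rule ln_prod[OF finite_lessThan]) (metis fac[OF that] less_irrefl)
    have "0 < (\<Prod>k<n. (1 - q powr (as ! i + real k)) / (1 - q powr (bs ! i + real k)))" if "i < length as" for i
      by (intro prod_pos fac that)
    then have "ln (q_pochhammer_ratio q as bs n) =
        (\<Sum>i<length as. ln (\<Prod>k<n. (1 - q powr (as ! i + real k)) / (1 - q powr (bs ! i + real k))))"
      unfolding q_pochhammer_ratio_def by (intro ln_prod[OF finite_lessThan]) (metis lessThan_iff less_irrefl)
    then show ?thesis by (simp add: inner)
  qed
  finally show ?thesis .
qed

text \<open>Nonnegativity of v is what turns the coefficients of the expansion into Poisson intensities.\<close>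
lemma moment_positive_q_pochhammer_ratio:
  assumes q: "0 < q" "q < 1"
    and pos: "\<And>i. i < length as \<Longrightarrow> 0 < as ! i" "\<And>i. i < length as \<Longrightarrow> 0 < bs ! i"
    and v: "\<And>t. 0 \<le> t \<Longrightarrow> t \<le> 1 \<Longrightarrow> 0 \<le> v_fun as bs t"
  shows "moment_positive (q_pochhammer_ratio q as bs)"
proof (rule moment_positive_LIMSEQ)
  let ?\<mu> = "\<lambda>j. v_fun as bs (q ^ j) / (real j * (1 - q ^ j))"
  show "moment_positive (\<lambda>n. exp (- (\<Sum>j<J. ?\<mu> j * (1 - (q ^ j) ^ n))))" for J
    by (intro moment_positive_exp_sum conjI divide_nonneg_nonneg v mult_nonneg_nonneg)
       (use q in \<open>auto simp: power_le_one\<close>)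
  fix n
  have lt1: "q powr (as ! i + real k) < 1" "q powr (bs ! i + real k) < 1"
    if "i < length as" for i k
    using pos[OF that] q by (auto intro!: powr_lt_1)
  have "q_pochhammer_ratio q as bs n > 0"
    unfolding q_pochhammer_ratio_def using lt1 by (auto intro!: prod_pos divide_pos_pos)
  then have "exp (- (- ln (q_pochhammer_ratio q as bs n))) = q_pochhammer_ratio q as bs n"
    by simp
  moreover have "(\<lambda>J. exp (- (\<Sum>j<J. ?\<mu> j * (1 - (q ^ j) ^ n))))
      \<longlonglongrightarrow> exp (- (- ln (q_pochhammer_ratio q as bs n)))"
    using ln_q_pochhammer_ratio_sums[OF q pos] unfolding sums_def
    by (intro tendsto_exp tendsto_minus)
  ultimately show "(\<lambda>J. exp (- (\<Sum>j<J. ?\<mu> j * (1 - (q ^ j) ^ n)))) \<longlonglongrightarrow> q_pochhammer_ratio q as bs n"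
    by metis
qed

text \<open>With q = exp (-h) this is the derivative at 0 of h \<mapsto> 1 - exp (-hx).\<close>
lemma q_number_tendsto:
  fixes x :: real
  assumes "0 < x"
  shows "(\<lambda>N. real (Suc N) * (1 - exp (- 1 / real (Suc N)) powr x)) \<longlonglongrightarrow> x"
proof -
  have "(\<lambda>N. - (x * inverse (real (Suc N)))) \<longlonglongrightarrow> - (x * 0)"
    by (intro tendsto_intros LIMSEQ_inverse_real_of_nat)
  then have lim: "filterlim (\<lambda>N. - (x * inverse (real (Suc N)))) (at 0) sequentially"
    unfolding filterlim_at using assms by auto
  have "(\<lambda>N. x * ((exp (- (x * inverse (real (Suc N)))) - 1) / (- (x * inverse (real (Suc N)))))) \<longlonglongrightarrow> x * 1"
    by (intro tendsto_mult tendsto_const filterlim_compose[OF lim_exp_minus_1 lim])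
  also have "(\<lambda>N. x * ((exp (- (x * inverse (real (Suc N)))) - 1) / (- (x * inverse (real (Suc N)))))) =
      (\<lambda>N. real (Suc N) * (1 - exp (- 1 / real (Suc N)) powr x))"
    using assms by (intro ext) (simp add: powr_def field_simps)
  finally show ?thesis by simp
qed

lemma q_pochhammer_ratio_tendsto:
  assumes pos: "\<And>i. i < length as \<Longrightarrow> 0 < as ! i" "\<And>i. i < length as \<Longrightarrow> 0 < bs ! i"
  shows "(\<lambda>N. q_pochhammer_ratio (exp (- 1 / real (Suc N))) as bs n) \<longlonglongrightarrow> pochhammer_ratio as bs n"
proof -
  let ?q = "\<lambda>N. exp (- 1 / real (Suc N))"
  have "(\<lambda>N. (real (Suc N) * (1 - ?q N powr x)) / (real (Suc N) * (1 - ?q N powr y))) \<longlonglongrightarrow> x / y"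
    if "0 < x" "0 < y" for x y
    using that by (intro tendsto_divide q_number_tendsto) auto
  then have fac: "(\<lambda>N. (1 - ?q N powr x) / (1 - ?q N powr y)) \<longlonglongrightarrow> x / y" if "0 < x" "0 < y" for x y
    using that by simp
  have "(\<lambda>N. q_pochhammer_ratio (?q N) as bs n) \<longlonglongrightarrow>
     (\<Prod>i<length as. \<Prod>k<n. (as ! i + real k) / (bs ! i + real k))"
    unfolding q_pochhammer_ratio_def
    by (intro tendsto_prod fac) (use pos in \<open>auto simp: add_pos_nonneg\<close>)
  also have "(\<Prod>i<length as. \<Prod>k<n. (as ! i + real k) / (bs ! i + real k)) = pochhammer_ratio as bs n"
    by (simp add: pochhammer_ratio_def pochhammer_prod prod_dividef lessThan_atLeast0)
  finally show ?thesis .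
qed

lemma moment_positive_pochhammer_ratio:
  assumes "\<And>i. i < length as \<Longrightarrow> 0 < as ! i" "\<And>i. i < length as \<Longrightarrow> 0 < bs ! i"
    and "\<And>t. 0 \<le> t \<Longrightarrow> t \<le> 1 \<Longrightarrow> 0 \<le> v_fun as bs t"
  shows "moment_positive (pochhammer_ratio as bs)"
  by (rule moment_positive_LIMSEQ[OF moment_positive_q_pochhammer_ratio q_pochhammer_ratio_tendsto])
     (use assms in auto)

section \<open>Decay of Pochhammer quotients\<close>

text \<open>The polynomial whose value at n is the product of all x + n; it turns the recurrence of
Pochhammer quotients into a quotient of polynomials in n.\<close>
definition shift_poly :: "real list \<Rightarrow> real poly" where
  "shift_poly xs = (\<Prod>x\<leftarrow>xs. [:x, 1:])"

lemma poly_shift_poly: "poly (shift_poly xs) t = (\<Prod>i<length xs. xs ! i + t)"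
proof -
  have "poly (shift_poly xs) t = (\<Prod>x\<leftarrow>xs. x + t)"
    unfolding shift_poly_def by (induction xs) (auto simp: algebra_simps)
  then show ?thesis
    by (simp add: prod.list_conv_set_nth lessThan_atLeast0)
qed

text \<open>The parameters are the negated roots, counted with multiplicity.\<close>
lemma mset_eq_if_shift_poly_eq:
  assumes "shift_poly as = shift_poly bs"
  shows "mset as = mset bs"
proof -
  have nz: "shift_poly xs \<noteq> 0" for xs
    unfolding shift_poly_def by (auto simp: prod_list_zero_iff)
  have "proots (shift_poly xs) = image_mset uminus (mset xs)" for xs
  proof (induction xs)
    case Nil
    then show ?case by (simp add: shift_poly_def)
  next
    case (Cons x xs)
    have "proots (shift_poly (x # xs)) = proots ([:x, 1:] * shift_poly xs)"
      by (simp add: shift_poly_def)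
    also have "\<dots> = {#-x#} + proots (shift_poly xs)"
      by (subst proots_mult) (auto simp: nz)
    finally show ?case using Cons by simp
  qed
  with assms have "image_mset uminus (image_mset uminus (mset as)) = image_mset uminus (image_mset uminus (mset bs))"
    by metis
  then show ?thesis by (simp add: multiset.map_comp o_def)
qed

lemma poly_bounded_away_from_0:
  fixes p :: "real poly"
  assumes "p \<noteq> 0"
  shows "\<exists>c>0. \<forall>\<^sub>F n in sequentially. c \<le> \<bar>poly p (real n)\<bar>"
proof -
  have large: "\<exists>c>0. \<forall>\<^sub>F n in sequentially. c \<le> poly q (real n)" if "0 < lead_coeff q" for q :: "real poly"
  proof -
    obtain M where "\<forall>x\<ge>M. lead_coeff q \<le> poly q x"
      using poly_pinfty_gt_lc[OF \<open>0 < lead_coeff q\<close>] by blast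
    moreover have "\<forall>\<^sub>F n in sequentially. M \<le> real n"
      using filterlim_real_sequentially by (auto simp: filterlim_at_top)
    ultimately have "\<forall>\<^sub>F n in sequentially. lead_coeff q \<le> poly q (real n)"
      by (auto elim: eventually_mono)
    with that show ?thesis by blast
  qed
  from assms consider "0 < lead_coeff p" | "0 < lead_coeff (- p)"
    by (metis lead_coeff_minus leading_coeff_0_iff linorder_neqE_linordered_idom neg_0_less_iff_less)
  then obtain c where "0 < c" "(\<forall>\<^sub>F n in sequentially. c \<le> poly p (real n)) \<or> (\<forall>\<^sub>F n in sequentially. c \<le> - poly p (real n))"
    by cases (use large[of p] large[of "- p"] in auto)
  moreover from this have "\<forall>\<^sub>F n in sequentially. c \<le> \<bar>poly p (real n)\<bar>"
    by (auto elim!: eventually_mono)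
  ultimately show ?thesis by blast
qed

lemma shifted_ratio_tendsto_1:
  fixes a b :: real
  assumes "0 < b"
  shows "(\<lambda>n. (a + real n) / (b + real n)) \<longlonglongrightarrow> 1"
proof -
  have "filterlim (\<lambda>n. b + real n) at_top sequentially"
    by (rule filterlim_tendsto_add_at_top[OF tendsto_const filterlim_real_sequentially])
  then have "(\<lambda>n. (a - b) / (b + real n)) \<longlonglongrightarrow> 0"
    by (intro tendsto_divide_0[OF tendsto_const] filterlim_at_top_imp_at_infinity)
  then have "(\<lambda>n. 1 + (a - b) / (b + real n)) \<longlonglongrightarrow> 1 + 0"
    by (intro tendsto_add tendsto_const)
  moreover have "(\<lambda>n. 1 + (a - b) / (b + real n)) = (\<lambda>n. (a + real n) / (b + real n))"
  proof
    fix n show "1 + (a - b) / (b + real n) = (a + real n) / (b + real n)"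
      using assms by (simp add: divide_simps add_pos_nonneg add_eq_0_iff)
  qed
  ultimately show ?thesis by simp
qed

text \<open>Quotients of consecutive terms near 1 keep the sequence above \<rho>^n, up to a constant, for
every \<rho> < 1, in particular for some \<rho> between \<tau> and 1.\<close>
lemma ratio_1_not_geometric:
  fixes x :: "nat \<Rightarrow> real"
  assumes pos: "\<And>n. 0 < x n" and ratio: "(\<lambda>n. x (Suc n) / x n) \<longlonglongrightarrow> 1"
    and \<tau>: "0 \<le> \<tau>" "\<tau> < 1" and c: "0 < c"
  shows "\<not> (\<forall>\<^sub>F n in sequentially. c * x n \<le> \<tau> ^ n)"
proof
  assume "\<forall>\<^sub>F n in sequentially. c * x n \<le> \<tau> ^ n"
  obtain \<rho> where \<rho>: "\<tau> < \<rho>" "\<rho> < 1" using \<tau> dense by blast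
  have "\<forall>\<^sub>F n in sequentially. \<rho> < x (Suc n) / x n"
    by (rule order_tendstoD(1)[OF ratio \<rho>(2)])
  with \<open>\<forall>\<^sub>F n in sequentially. c * x n \<le> \<tau> ^ n\<close>
  have "\<forall>\<^sub>F n in sequentially. c * x n \<le> \<tau> ^ n \<and> \<rho> < x (Suc n) / x n"
    by (rule eventually_conj)
  then obtain N where N: "\<And>n. n \<ge> N \<Longrightarrow> c * x n \<le> \<tau> ^ n \<and> \<rho> < x (Suc n) / x n"
    unfolding eventually_sequentially by blast
  have lower: "\<rho> ^ k * x N \<le> x (N + k)" for k
  proof (induction k)
    case (Suc k)
    have "\<rho> ^ Suc k * x N = \<rho> * (\<rho> ^ k * x N)" by simp
    also have "\<dots> \<le> \<rho> * x (N + k)"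
      using Suc \<rho> \<tau> by (intro mult_left_mono) auto
    also have "\<dots> \<le> x (N + Suc k)"
      using N[of "N + k"] pos[of "N + k"] by (simp add: field_simps)
    finally show ?case .
  qed simp
  have "c * x N \<le> (\<tau> / \<rho>) ^ k" for k
  proof -
    have "\<rho> ^ k * (c * x N) = c * (\<rho> ^ k * x N)" by simp
    also have "\<dots> \<le> c * x (N + k)" using lower c by (intro mult_left_mono) auto
    also have "\<dots> \<le> \<tau> ^ (N + k)" using N[of "N + k"] by simp
    also have "\<dots> \<le> \<tau> ^ k" using \<tau> by (intro power_decreasing) auto
    finally show ?thesis using \<rho> \<tau> by (simp add: power_divide field_simps)
  qed
  moreover have "(\<lambda>k. (\<tau> / \<rho>) ^ k) \<longlonglongrightarrow> 0"
    using \<rho> \<tau> by (intro LIMSEQ_realpow_zero) auto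
  ultimately have "c * x N \<le> 0"
    by (meson LIMSEQ_le_const)
  then show False using c pos[of N] by (simp add: mult_le_0_iff)
qed

lemma pochhammer_ratio_0: "pochhammer_ratio as bs 0 = 1"
  by (simp add: pochhammer_ratio_def)

context
  fixes as bs :: "real list"
  assumes len: "length bs = length as"
    and as_pos: "\<And>i. i < length as \<Longrightarrow> 0 < as ! i"
    and bs_pos: "\<And>i. i < length as \<Longrightarrow> 0 < bs ! i"
    and mp: "moment_positive (pochhammer_ratio as bs)"
begin

lemma shift_poly_pos:
  "0 < poly (shift_poly as) (real n)" "0 < poly (shift_poly bs) (real n)"
  by (auto simp: poly_shift_poly len intro!: prod_pos add_pos_nonneg as_pos bs_pos)

lemma pochhammer_ratio_Suc:
  "pochhammer_ratio as bs (Suc n) =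
     pochhammer_ratio as bs n * (poly (shift_poly as) (real n) / poly (shift_poly bs) (real n))"
  by (simp add: pochhammer_ratio_def poly_shift_poly len pochhammer_Suc prod_dividef prod.distrib)

lemma pochhammer_ratio_pos: "0 < pochhammer_ratio as bs n"
  by (induction n) (auto simp: pochhammer_ratio_0 pochhammer_ratio_Suc shift_poly_pos)

lemma pochhammer_ratio_diff:
  "pochhammer_ratio as bs n - pochhammer_ratio as bs (Suc n) =
     pochhammer_ratio as bs n / poly (shift_poly bs) (real n) *
       poly (shift_poly bs - shift_poly as) (real n)"
  using shift_poly_pos[of n] by (simp add: pochhammer_ratio_Suc divide_simps) (simp add: algebra_simps)

text \<open>With x_n = m_n / \<Prod>i. (b_i + n) the difference m_n - m_(n+1) is x_n times a polynomial in
n, which stays away from 0 because it is not the zero polynomial; and x_(n+1)/x_n tends to 1.\<close>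
lemma pochhammer_ratio_not_geometric:
  assumes "mset bs \<noteq> mset as" "0 \<le> \<tau>" "\<tau> < 1"
  shows "\<exists>n. \<tau> ^ n < pochhammer_ratio as bs n - pochhammer_ratio as bs (Suc n)"
proof (rule ccontr)
  assume "\<not> ?thesis"
  then have le: "pochhammer_ratio as bs n - pochhammer_ratio as bs (Suc n) \<le> \<tau> ^ n" for n
    by (meson not_less)
  have "shift_poly bs - shift_poly as \<noteq> 0"
    using mset_eq_if_shift_poly_eq[of bs as] assms(1) by auto
  then obtain c where c: "0 < c" "\<forall>\<^sub>F n in sequentially. c \<le> \<bar>poly (shift_poly bs - shift_poly as) (real n)\<bar>"
    using poly_bounded_away_from_0 by blast
  define x where "x n = pochhammer_ratio as bs n / poly (shift_poly bs) (real n)" for n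
  have x_pos: "0 < x n" for n
    unfolding x_def by (intro divide_pos_pos pochhammer_ratio_pos shift_poly_pos)
  have "x (Suc n) / x n = (\<Prod>i<length as. (as ! i + real n) / ((bs ! i + 1) + real n))" for n
  proof -
    have "x (Suc n) / x n = poly (shift_poly as) (real n) / poly (shift_poly bs) (real (Suc n))"
      using shift_poly_pos[of n] shift_poly_pos(2)[of "Suc n"] pochhammer_ratio_pos[of n]
      unfolding x_def pochhammer_ratio_Suc by (simp add: divide_simps)
    then show ?thesis
      by (simp add: poly_shift_poly len prod_dividef add_ac)
  qed
  moreover have "(\<lambda>n. \<Prod>i<length as. (as ! i + real n) / ((bs ! i + 1) + real n)) \<longlonglongrightarrow> (\<Prod>i<length as. 1)"
    by (intro tendsto_prod shifted_ratio_tendsto_1) (use bs_pos in \<open>auto simp: add_pos_pos\<close>)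
  ultimately have ratio: "(\<lambda>n. x (Suc n) / x n) \<longlonglongrightarrow> 1"
    by simp
  have "\<forall>\<^sub>F n in sequentially. c * x n \<le> \<tau> ^ n"
    using c(2)
  proof eventually_elim
    case (elim n)
    have "c * x n \<le> \<bar>poly (shift_poly bs - shift_poly as) (real n)\<bar> * x n"
      using elim x_pos[of n] by (intro mult_right_mono) auto
    also have "\<dots> = \<bar>pochhammer_ratio as bs n - pochhammer_ratio as bs (Suc n)\<bar>"
      using x_pos[of n] unfolding pochhammer_ratio_diff x_def[symmetric] by (simp add: abs_mult)
    also have "\<dots> = pochhammer_ratio as bs n - pochhammer_ratio as bs (Suc n)"
      using moment_positive_antimono[OF mp, of n "Suc n"] by simp
    also have "\<dots> \<le> \<tau> ^ n" by (rule le)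
    finally show ?case .
  qed
  with ratio_1_not_geometric[OF x_pos ratio assms(2,3) c(1)] show False by blast
qed

text \<open>If the first moment is 1, the measure sits at the point 1 and all differences of moments vanish,
which is an extreme case of geometric decay.\<close>
lemma pochhammer_ratio_1_less_1:
  assumes "mset bs \<noteq> mset as"
  shows "pochhammer_ratio as bs 1 < 1"
proof (rule ccontr)
  assume "\<not> ?thesis"
  then have "pochhammer_ratio as bs n - pochhammer_ratio as bs (Suc n) \<le> 0" for n
    using moment_positive_diff_le[OF mp, of n] by (simp add: pochhammer_ratio_0)
  then show False
    using pochhammer_ratio_not_geometric[OF assms, of 0] zero_le_power[of "0::real"]
    by (metis less_eq_real_def not_less order_trans zero_less_one)
qed

end

section \<open>Cosine transforms of moment sequences\<close>

text \<open>Expressions in a bounded sequence r of the form \<Sum>n. c_n r_n.  Applied to r_n = t^n they are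
functions of t given by a power series, and applied to a moment sequence they are the integrals of
these functions, so a pointwise inequality in t can be integrated without naming the coefficients.\<close>
definition power_series_functional :: "((nat \<Rightarrow> real) \<Rightarrow> real) \<Rightarrow> bool" where
  "power_series_functional \<Phi> \<longleftrightarrow>
     (\<exists>c. \<forall>r. (\<forall>n. \<bar>r n\<bar> \<le> 1) \<longrightarrow> (\<lambda>n. c n * r n) sums \<Phi> r)"

text \<open>Convergence for every sequence bounded by 1 includes the signs of the coefficients and thereby
yields the absolute convergence that positivity on power series requires.\<close>
lemma moment_positive_functional:
  assumes s: "moment_positive s" "s 0 = 1" and \<Phi>: "power_series_functional \<Phi>"
    and nonneg: "\<And>t. 0 \<le> t \<Longrightarrow> t \<le> 1 \<Longrightarrow> 0 \<le> \<Phi> (\<lambda>n. t ^ n)"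
  shows "0 \<le> \<Phi> s"
proof -
  obtain c where c: "\<And>r. (\<And>n. \<bar>r n\<bar> \<le> 1) \<Longrightarrow> (\<lambda>n. c n * r n) sums \<Phi> r"
    using \<Phi> unfolding power_series_functional_def by blast
  have s_le: "\<bar>s n\<bar> \<le> 1" for n
    by (rule moment_positive_abs_le_1[OF s])
  have "summable (\<lambda>n. c n * sgn (c n))"
    by (rule sums_summable[OF c]) (simp add: abs_sgn_eq)
  then have "summable (\<lambda>n. \<bar>c n\<bar>)"
    by (simp add: abs_sgn)
  moreover have "0 \<le> (\<Sum>n. c n * t ^ n)" if "0 \<le> t" "t \<le> 1" for t
    using nonneg[OF that] sums_unique[OF c[of "\<lambda>n. t ^ n"]] that by (simp add: power_le_one)
  ultimately have "0 \<le> (\<Sum>n. c n * s n)"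
    by (intro moment_positive_suminf[OF s(1)] sums_summable[OF c] s_le)
  with sums_unique[OF c[OF s_le]] show ?thesis by simp
qed

lemma power_series_functional_coord: "power_series_functional (\<lambda>r. r k)"
  unfolding power_series_functional_def
proof (intro exI[of _ "\<lambda>n. if n = k then 1 else 0"] allI impI)
  fix r :: "nat \<Rightarrow> real"
  have "(\<lambda>n. if n = k then r n else 0) sums r k"
    by (rule sums_single)
  also have "(\<lambda>n. if n = k then r n else 0) = (\<lambda>n. (if n = k then 1 else 0) * r n)"
    by auto
  finally show "(\<lambda>n. (if n = k then 1 else 0) * r n) sums r k" .
qed

lemma power_series_functional_add:
  assumes "power_series_functional \<Phi>" "power_series_functional \<Psi>"
  shows "power_series_functional (\<lambda>r. \<Phi> r + \<Psi> r)"
proof -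
  obtain c d where "\<forall>r. (\<forall>n. \<bar>r n\<bar> \<le> 1) \<longrightarrow> (\<lambda>n. c n * r n) sums \<Phi> r"
    "\<forall>r. (\<forall>n. \<bar>r n\<bar> \<le> 1) \<longrightarrow> (\<lambda>n. d n * r n) sums \<Psi> r"
    using assms unfolding power_series_functional_def by blast
  then show ?thesis unfolding power_series_functional_def
    by (intro exI[of _ "\<lambda>n. c n + d n"]) (simp add: distrib_right sums_add)
qed

lemma power_series_functional_cmult:
  assumes "power_series_functional \<Phi>"
  shows "power_series_functional (\<lambda>r. a * \<Phi> r)"
proof -
  obtain c where "\<forall>r. (\<forall>n. \<bar>r n\<bar> \<le> 1) \<longrightarrow> (\<lambda>n. c n * r n) sums \<Phi> r"
    using assms unfolding power_series_functional_def by blast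
  then show ?thesis unfolding power_series_functional_def
    by (intro exI[of _ "\<lambda>n. a * c n"]) (simp add: mult.assoc sums_mult)
qed

lemma power_series_functional_diff:
  assumes "power_series_functional \<Phi>" "power_series_functional \<Psi>"
  shows "power_series_functional (\<lambda>r. \<Phi> r - \<Psi> r)"
  using power_series_functional_add[OF assms(1) power_series_functional_cmult[OF assms(2), of "-1"]]
  by simp

lemmas power_series_functional_intros = power_series_functional_coord
  power_series_functional_add power_series_functional_cmult power_series_functional_diff

text \<open>The integral of cos (z * sqrt t) against the measure with moments r_n.\<close>
definition cos_transform :: "(nat \<Rightarrow> real) \<Rightarrow> complex \<Rightarrow> complex" where
  "cos_transform r z = (\<Sum>n. of_real (r n) * (- (z\<^sup>2)) ^ n / fact (2 * n))"

lemma cosh_sums: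
  fixes x :: "'a :: {real_normed_field, banach}"
  shows "(\<lambda>n. x ^ (2 * n) / fact (2 * n)) sums cosh x"
proof -
  have "(\<lambda>n. if even (2 * n) then x ^ (2 * n) /\<^sub>R fact (2 * n) else 0) sums cosh x"
    using cosh_converges[of x]
    by (subst sums_mono_reindex[of "\<lambda>n. 2 * n"]) (auto simp: strict_mono_def elim!: evenE)
  then show ?thesis
    by (simp add: scaleR_conv_of_real divide_inverse mult.commute)
qed

lemma cos_sums: "(\<lambda>n. (- (z\<^sup>2)) ^ n / fact (2 * n)) sums cos (z :: complex)"
proof -
  have "(\<i> * z) ^ (2 * n) = (- (z\<^sup>2)) ^ n" for n
    unfolding power_mult by (simp add: power_mult_distrib)
  then show ?thesis
    using cosh_sums[of "\<i> * z"] by (simp add: cosh_conv_cos mult.assoc[symmetric])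
qed

lemma cos_transform_sums:
  assumes "\<And>n. \<bar>r n\<bar> \<le> 1"
  shows "(\<lambda>n. of_real (r n) * (- (z\<^sup>2)) ^ n / fact (2 * n)) sums cos_transform r z"
proof -
  have "summable (\<lambda>n. norm z ^ (2 * n) / fact (2 * n))"
    using cosh_sums by (rule sums_summable)
  then have "summable (\<lambda>n. of_real (r n) * (- (z\<^sup>2)) ^ n / fact (2 * n) :: complex)"
  proof (rule summable_comparison_test'[of _ 0])
    fix n
    have "norm (of_real (r n) * (- (z\<^sup>2)) ^ n / fact (2 * n) :: complex) = \<bar>r n\<bar> * (norm z ^ (2 * n) / fact (2 * n))"
      by (simp add: norm_mult norm_divide norm_power power_mult)
    also have "\<dots> \<le> 1 * (norm z ^ (2 * n) / fact (2 * n))"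
      by (intro mult_right_mono assms) auto
    finally show "norm (of_real (r n) * (- (z\<^sup>2)) ^ n / fact (2 * n) :: complex) \<le> norm z ^ (2 * n) / fact (2 * n)"
      by simp
  qed
  then show ?thesis
    unfolding cos_transform_def by (rule summable_sums)
qed

lemma cos_transform_power:
  assumes "0 \<le> t"
  shows "cos_transform (\<lambda>n. t ^ n) z = cos (of_real (sqrt t) * z)"
proof -
  have "(of_real (sqrt t) * z)\<^sup>2 = of_real t * z\<^sup>2"
    using assms by (simp add: power_mult_distrib flip: of_real_power)
  then have "(- ((of_real (sqrt t) * z)\<^sup>2)) ^ n = of_real (t ^ n) * (- (z\<^sup>2)) ^ n" for n
    unfolding of_real_power power_mult_distrib[symmetric] by simp
  then show ?thesis
    using sums_unique[OF cos_sums[of "of_real (sqrt t) * z"]]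
    by (simp add: cos_transform_def)
qed

lemma power_series_functional_cos_transform:
  "power_series_functional (\<lambda>r. Re (e * cos_transform r z))"
  unfolding power_series_functional_def
proof (intro exI allI impI)
  fix r :: "nat \<Rightarrow> real" assume "\<forall>n. \<bar>r n\<bar> \<le> 1"
  then have "(\<lambda>n. Re (e * (of_real (r n) * (- (z\<^sup>2)) ^ n / fact (2 * n)))) sums Re (e * cos_transform r z)"
    by (intro sums_Re sums_mult cos_transform_sums) auto
  moreover have "Re (e * (of_real (r n) * (- (z\<^sup>2)) ^ n / fact (2 * n))) =
      Re (e * (- (z\<^sup>2)) ^ n / fact (2 * n)) * r n" for n
  proof -
    have eq: "e * (of_real (r n) * (- (z\<^sup>2)) ^ n / fact (2 * n)) = (e * (- (z\<^sup>2)) ^ n / fact (2 * n)) * of_real (r n)"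
      by simp
    have "Re (x * of_real a) = Re x * a" for x a by simp
    then show ?thesis unfolding eq .
  qed
  ultimately show "(\<lambda>n. Re (e * (- (z\<^sup>2)) ^ n / fact (2 * n)) * r n) sums Re (e * cos_transform r z)"
    by simp
qed

lemma norm_cos_le_cosh: "norm (cos z) \<le> cosh (Im z)" for z :: complex
proof -
  have "norm (cos z) = norm (exp (\<i> * z) + exp (- (\<i> * z))) / 2"
    by (simp add: cos_exp_eq norm_divide)
  also have "\<dots> \<le> (norm (exp (\<i> * z)) + norm (exp (- (\<i> * z)))) / 2"
    by (intro divide_right_mono norm_triangle_ineq) simp
  also have "\<dots> = cosh (Im z)"
    by (simp add: cosh_def)
  finally show ?thesis .
qed

text \<open>Apart from the constant term, every term of the series of cosh (u * y) is at most u^2 times the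
corresponding term of the series of cosh y.\<close>
lemma cosh_mult_le:
  fixes u y :: real
  assumes "0 \<le> u" "u \<le> 1"
  shows "cosh (u * y) \<le> 1 + u\<^sup>2 * (cosh y - 1)"
proof -
  have *: "(\<lambda>n. (if n = 0 then 1 - u\<^sup>2 else 0) + u\<^sup>2 * (y ^ (2 * n) / fact (2 * n))) sums ((1 - u\<^sup>2) + u\<^sup>2 * cosh y)"
    by (intro sums_add sums_single sums_mult cosh_sums)
  have "cosh (u * y) \<le> (1 - u\<^sup>2) + u\<^sup>2 * cosh y"
  proof (rule sums_le[OF _ cosh_sums *])
    fix n
    show "(u * y) ^ (2 * n) / fact (2 * n) \<le> (if n = 0 then 1 - u\<^sup>2 else 0) + u\<^sup>2 * (y ^ (2 * n) / fact (2 * n))"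
    proof (cases "n = 0")
      case False
      then have "u ^ (2 * n) \<le> u\<^sup>2"
        using assms by (intro power_decreasing) auto
      then have "u ^ (2 * n) * (y ^ (2 * n) / fact (2 * n)) \<le> u\<^sup>2 * (y ^ (2 * n) / fact (2 * n))"
        by (intro mult_right_mono) auto
      with False show ?thesis by (simp add: power_mult_distrib)
    qed simp
  qed
  then show ?thesis by (simp add: algebra_simps)
qed

context
  fixes s :: "nat \<Rightarrow> real"
  assumes s: "moment_positive s" "s 0 = 1"
begin

text \<open>Rotating by a unimodular e reduces the modulus to a real part, where
Re (e cos (z * sqrt t)) \<le> cosh (sqrt t * Im z) \<le> 1 + t (cosh (Im z) - 1) can be integrated.
The bound contains only the first moment, which makes it strictly smaller than cosh (Im z) off the
real axis as soon as s_1 < 1.\<close>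
lemma norm_cos_transform_le:
  "norm (cos_transform s z) \<le> 1 + s 1 * (cosh (Im z) - 1)"
proof (cases "cos_transform s z = 0")
  case True
  then show ?thesis
    using moment_positive_nonneg[OF s(1), of 1] cosh_real_ge_1[of "Im z"] by simp
next
  case False
  define w where "w = cos_transform s z"
  define e where "e = cnj w / of_real (norm w)"
  have e: "norm e = 1" "e * w = of_real (norm w)"
    using False by (auto simp: e_def w_def norm_divide complex_norm_square[symmetric] power2_eq_square mult.commute)
  have "0 \<le> s 0 + (cosh (Im z) - 1) * s 1 - Re (e * cos_transform s z)"
  proof (rule moment_positive_functional[OF s])
    fix t :: real assume t: "0 \<le> t" "t \<le> 1"
    have "Re (e * cos (of_real (sqrt t) * z)) \<le> norm (e * cos (of_real (sqrt t) * z))"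
      by (rule complex_Re_le_cmod)
    also have "\<dots> \<le> cosh (sqrt t * Im z)"
      using norm_cos_le_cosh[of "of_real (sqrt t) * z"] e by (simp add: norm_mult)
    also have "\<dots> \<le> 1 + t * (cosh (Im z) - 1)"
      using cosh_mult_le[of "sqrt t" "Im z"] t by simp
    finally show "0 \<le> t ^ 0 + (cosh (Im z) - 1) * t ^ 1 - Re (e * cos_transform (\<lambda>n. t ^ n) z)"
      using t by (simp add: cos_transform_power algebra_simps)
  qed (intro power_series_functional_intros power_series_functional_cos_transform)
  moreover have "Re (e * cos_transform s z) = norm (cos_transform s z)"
    using e(2) by (simp only: w_def Re_complex_of_real)
  ultimately show ?thesis
    using s(2) by (simp only: mult.commute)
qed

text \<open>Integrated form of 1 - cos 2\<theta> = 2 (1 - cos \<theta>)(1 + cos \<theta>) \<le> 4 (1 - \<sigma> * cos \<theta>).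
It transfers the extreme values 1 and -1 at x to the value 1 at 2x.\<close>
lemma cos_transform_double:
  assumes "\<sigma> = 1 \<or> \<sigma> = - 1"
  shows "1 - Re (cos_transform s (of_real (2 * x))) \<le> 4 * (1 - \<sigma> * Re (cos_transform s (of_real x)))"
proof -
  have "0 \<le> 4 * (s 0 - \<sigma> * Re (1 * cos_transform s (of_real x)))
            - (s 0 - Re (1 * cos_transform s (of_real (2 * x))))"
  proof (rule moment_positive_functional[OF s])
    fix t :: real assume t: "0 \<le> t" "t \<le> 1"
    define c where "c = cos (sqrt t * x)"
    have "cos (sqrt t * (2 * x)) = 2 * c\<^sup>2 - 1"
      using cos_double_cos[of "sqrt t * x"] by (simp add: c_def mult_ac)
    moreover have "4 * (1 - \<sigma> * c) - (1 - (2 * c\<^sup>2 - 1)) = 2 * (1 - \<sigma> * c)\<^sup>2"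
      using assms by (auto simp: power2_eq_square algebra_simps)
    moreover from this have "0 \<le> 4 * (1 - \<sigma> * c) - (1 - (2 * c\<^sup>2 - 1))" by simp
    ultimately show "0 \<le> 4 * (t ^ 0 - \<sigma> * Re (1 * cos_transform (\<lambda>n. t ^ n) (of_real x)))
            - (t ^ 0 - Re (1 * cos_transform (\<lambda>n. t ^ n) (of_real (2 * x))))"
      using t by (simp add: cos_transform_power c_def cos_of_real flip: of_real_mult)
  qed (intro power_series_functional_intros power_series_functional_cos_transform)
  then show ?thesis using s by simp
qed

end

lemma cos_transform_minus: "cos_transform r (- z) = cos_transform r z"
  by (simp add: cos_transform_def)

lemma cos_transform_holomorphic:
  assumes "\<And>n. \<bar>r n\<bar> \<le> 1"
  shows "cos_transform r holomorphic_on A"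
proof -
  define F where "F = Abs_fps (\<lambda>n. of_real (r n) / fact (2 * n) :: complex)"
  have eq: "cos_transform r z = eval_fps F (- (z\<^sup>2))" for z
    by (simp add: cos_transform_def eval_fps_def F_def)
  have "conv_radius (fps_nth F) = \<infinity>"
  proof (rule conv_radius_inftyI'')
    fix w :: complex
    have "(- ((csqrt (- w))\<^sup>2)) = w" by simp
    then show "summable (\<lambda>n. fps_nth F n * w ^ n)"
      using sums_summable[OF cos_transform_sums[OF assms, where z = "csqrt (- w)"]] by (simp add: F_def)
  qed
  then have "eval_fps F holomorphic_on UNIV"
    by (intro holomorphic_on_eval_fps) (simp add: fps_conv_radius_def eball_inf)
  moreover have "(\<lambda>z. - (z\<^sup>2)) holomorphic_on A"
    by (intro holomorphic_intros)
  ultimately have "(eval_fps F \<circ> (\<lambda>z. - (z\<^sup>2))) holomorphic_on A"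
    by (metis holomorphic_on_compose_gen subset_UNIV)
  then show ?thesis by (simp add: eq [abs_def] o_def)
qed

lemma cos_transform_cnj:
  assumes "\<And>n. \<bar>r n\<bar> \<le> 1"
  shows "cos_transform r (cnj z) = cnj (cos_transform r z)"
proof -
  have "(\<lambda>n. cnj (of_real (r n) * (- (z\<^sup>2)) ^ n / fact (2 * n))) sums cnj (cos_transform r z)"
    using cos_transform_sums[OF assms] by (simp only: sums_cnj)
  then show ?thesis
    by (simp add: cos_transform_def sums_iff)
qed

lemma cos_less_1_strictly_between:
  fixes J :: int
  assumes "2 * pi * of_int J < x" "x < 2 * pi * of_int (J + 1)"
  shows "cos x < 1"
proof -
  have "cos x \<noteq> 1"
  proof
    assume "cos x = 1"
    then obtain k :: int where k: "x = of_int k * 2 * pi" by (auto simp: cos_one_2pi_int)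
    have "2 * pi * of_int J < 2 * pi * of_int k" "2 * pi * of_int k < 2 * pi * of_int (J + 1)"
      using assms by (simp_all add: k mult_ac)
    then have "J < k" "k < J + 1"
      by (simp_all only: mult_less_cancel_left_pos[of "2 * pi"] pi_gt_zero of_int_less_iff mult_pos_pos zero_less_numeral)
    then show False by simp
  qed
  with cos_le_one[of x] show ?thesis by linarith
qed

context
  fixes s :: "nat \<Rightarrow> real"
  assumes s: "moment_positive s" "s 0 = 1"
begin

text \<open>The value 1 at y forces the measure onto the zeros of h(t) = 1 - cos (y * sqrt t).  Below 1 there
is a last such zero \<tau>_0, so the mass outside the point 1 lies in [0, \<tau>_0] and
s_n - s_(n+1), the integral of t^n (1 - t), decays at least like the powers of any number above \<tau>_0.
In terms of the functional: for every \<epsilon> > 0 the inequality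
t^n (1 - t) \<le> \<tau>^n + \<epsilon> + h(t)/c holds on the unit interval, where c is a
positive lower bound of h on [\<tau>, 1 - \<epsilon>], and the integral of h is not positive.\<close>
lemma geometric_decay_if_cos_transform_eq_1:
  assumes y: "0 < y" and eq1: "1 \<le> Re (cos_transform s (of_real y))"
  shows "\<exists>\<tau>. 0 \<le> \<tau> \<and> \<tau> < 1 \<and> (\<forall>n. s n - s (Suc n) \<le> \<tau> ^ n)"
proof -
  define J where "J = \<lceil>y / (2 * pi)\<rceil> - 1"
  have J: "of_int J < y / (2 * pi)" "y / (2 * pi) \<le> of_int (J + 1)"
    by (auto simp: J_def) linarith+
  have "0 < y / (2 * pi)" using y by simp
  then have "0 \<le> J" unfolding J_def by linarith
  have J': "2 * pi * of_int J < y" "y \<le> 2 * pi * of_int (J + 1)"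
    using J by (simp_all add: field_simps)
  \<comment> \<open>\<open>2 * pi * J\<close> is the last multiple of \<open>2 * pi\<close> strictly below \<open>y\<close>\<close>
  define \<tau>0 where "\<tau>0 = (2 * pi * of_int J / y)\<^sup>2"
  have "2 * pi * of_int J / y < 1" using J'(1) y by simp
  moreover have Jnn: "0 \<le> 2 * pi * of_int J / y" using \<open>0 \<le> J\<close> y by simp
  ultimately have \<tau>0: "0 \<le> \<tau>0" "\<tau>0 < 1"
    unfolding \<tau>0_def by (auto simp: power_less_one_iff abs_square_less_1)
  \<comment> \<open>any point strictly between \<open>\<tau>0\<close> and 1 serves: \<open>h\<close> vanishes at \<open>\<tau>0\<close> itself\<close>
  define \<tau> where "\<tau> = (\<tau>0 + 1) / 2"
  have \<tau>: "0 \<le> \<tau>" "\<tau>0 < \<tau>" "\<tau> < 1" using \<tau>0 by (auto simp: \<tau>_def)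
  have cos_less: "cos (sqrt t * y) < 1" if "\<tau>0 < t" "t < 1" for t
  proof (rule cos_less_1_strictly_between)
    have "2 * pi * of_int J / y < sqrt t"
      using that(1) Jnn unfolding \<tau>0_def by (simp add: real_less_rsqrt)
    then show "2 * pi * of_int J < sqrt t * y" using y by (simp add: field_simps)
    have "sqrt t < 1" using that by simp
    then have "sqrt t * y < y" using y by simp
    with J'(2) show "sqrt t * y < 2 * pi * of_int (J + 1)" by linarith
  qed
  have "s n - s (Suc n) \<le> \<tau> ^ n + \<epsilon>" if \<epsilon>: "0 < \<epsilon>" for n \<epsilon>
  proof -
    have "\<exists>c>0. \<forall>t\<in>{\<tau>..1 - \<epsilon>}. c \<le> 1 - cos (sqrt t * y)"
    proof (cases "{\<tau>..1 - \<epsilon>} = {}")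
      case True
      then show ?thesis by (intro exI[of _ 1]) auto
    next
      case False
      have "continuous_on {\<tau>..1 - \<epsilon>} (\<lambda>t. 1 - cos (sqrt t * y))"
        by (intro continuous_intros)
      with False obtain t0 where t0: "t0 \<in> {\<tau>..1 - \<epsilon>}"
        "\<forall>t\<in>{\<tau>..1 - \<epsilon>}. 1 - cos (sqrt t0 * y) \<le> 1 - cos (sqrt t * y)"
        using continuous_attains_inf[of "{\<tau>..1 - \<epsilon>}"] by blast
      moreover have "0 < 1 - cos (sqrt t0 * y)"
        using cos_less[of t0] t0(1) \<tau> \<epsilon> by auto
      ultimately show ?thesis by blast
    qed
    then obtain c where c: "0 < c" "\<And>t. \<tau> \<le> t \<Longrightarrow> t \<le> 1 - \<epsilon> \<Longrightarrow> c \<le> 1 - cos (sqrt t * y)"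
      by auto
    have "0 \<le> (\<tau> ^ n + \<epsilon>) * s 0 + (1 / c) * (s 0 - Re (1 * cos_transform s (of_real y))) - (s n - s (Suc n))"
    proof (rule moment_positive_functional[OF s])
      fix t :: real assume t: "0 \<le> t" "t \<le> 1"
      define h where "h = 1 - cos (sqrt t * y)"
      have "0 \<le> h" by (simp add: h_def)
      then have hc: "0 \<le> h / c" using c(1) by simp
      have "t ^ n * (1 - t) \<le> t ^ n * 1" "t ^ n * (1 - t) \<le> 1 * (1 - t)"
        using t by (intro mult_left_mono mult_right_mono; simp add: power_le_one)+
      then have le: "t ^ n * (1 - t) \<le> t ^ n" "t ^ n * (1 - t) \<le> 1 - t" by auto
      have "t ^ n * (1 - t) \<le> \<tau> ^ n + \<epsilon> + h / c"
      proof -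
        consider "t \<le> \<tau>" | "1 - \<epsilon> \<le> t" | "\<tau> \<le> t" "t \<le> 1 - \<epsilon>" by linarith
        then show ?thesis
        proof cases
          case 1
          then have "t ^ n \<le> \<tau> ^ n" using t by (intro power_mono)
          then show ?thesis using le hc \<epsilon> by linarith
        next
          case 2
          have "0 \<le> \<tau> ^ n" using \<tau> by simp
          then show ?thesis using 2 le hc by linarith
        next
          case 3
          then have "1 \<le> h / c" using c by (simp add: h_def)
          moreover have "0 \<le> \<tau> ^ n" using \<tau> by simp
          ultimately show ?thesis using le t \<epsilon> by linarith
        qed
      qed
      then show "0 \<le> (\<tau> ^ n + \<epsilon>) * t ^ 0 + (1 / c) * (t ^ 0 - Re (1 * cos_transform (\<lambda>n. t ^ n) (of_real y))) - (t ^ n - t ^ Suc n)"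
        using t by (simp add: cos_transform_power h_def cos_of_real diff_divide_distrib algebra_simps flip: of_real_mult)
    qed (intro power_series_functional_intros power_series_functional_cos_transform)
    moreover have "(1 / c) * (1 - Re (cos_transform s (of_real y))) \<le> 0"
      using eq1 c(1) by (simp add: mult_le_0_iff divide_le_0_iff)
    ultimately show ?thesis using s(2) by simp
  qed
  then have "s n - s (Suc n) \<le> \<tau> ^ n" for n
    by (rule field_le_epsilon)
  with \<tau> show ?thesis by blast
qed

lemma norm_cos_transform_real_less_1:
  assumes not_geo: "\<And>\<tau>. 0 \<le> \<tau> \<Longrightarrow> \<tau> < 1 \<Longrightarrow> \<exists>n. \<tau> ^ n < s n - s (Suc n)"
    and x: "x \<noteq> 0"
  shows "norm (cos_transform s (of_real x)) < 1"
proof (rule ccontr)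
  assume nl: "\<not> ?thesis"
  have "cos_transform s (of_real x) = cnj (cos_transform s (of_real x))"
    using cos_transform_cnj[OF moment_positive_abs_le_1[OF s], where z = "of_real x"] by simp
  then have real: "cos_transform s (of_real x) = of_real (Re (cos_transform s (of_real x)))"
    by (metis Reals_cnj_iff of_real_Re)
  have "norm (cos_transform s (of_real x)) = \<bar>Re (cos_transform s (of_real x))\<bar>"
    by (subst real) simp
  with nl have ge: "1 \<le> \<bar>Re (cos_transform s (of_real x))\<bar>" by simp
  have abs: "Re (cos_transform s (of_real \<bar>x\<bar>)) = Re (cos_transform s (of_real x))"
    by (cases "x \<ge> 0") (auto simp: cos_transform_minus)
  define \<sigma> where "\<sigma> = sgn (Re (cos_transform s (of_real x)))"
  have \<sigma>: "\<sigma> = 1 \<or> \<sigma> = - 1" using ge by (auto simp: \<sigma>_def sgn_if)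
  have "1 \<le> \<sigma> * Re (cos_transform s (of_real x))"
    using ge by (simp add: \<sigma>_def abs_sgn mult.commute)
  moreover have "1 - Re (cos_transform s (of_real (2 * \<bar>x\<bar>))) \<le> 4 * (1 - \<sigma> * Re (cos_transform s (of_real x)))"
    using cos_transform_double[OF s \<sigma>, of "\<bar>x\<bar>"] unfolding abs .
  moreover have "1 \<le> q" if "1 \<le> p" "1 - q \<le> 4 * (1 - p)" for p q :: real
    using that by (simp add: algebra_simps)
  ultimately have "1 \<le> Re (cos_transform s (of_real (2 * \<bar>x\<bar>)))" by blast
  from geometric_decay_if_cos_transform_eq_1[OF _ this] x obtain \<tau>
    where "0 \<le> \<tau>" "\<tau> < 1" "\<forall>n. s n - s (Suc n) \<le> \<tau> ^ n" by auto
  with not_geo show False by (meson not_less)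
qed

end

section \<open>Counting the zeros with the theorem of Rouche\<close>

lemma finite_zeros_entire:
  assumes "f holomorphic_on UNIV" "f w \<noteq> 0" "compact K"
  shows "finite {z \<in> K. f z = (0 :: complex)}"
proof (cases "f constant_on UNIV")
  case True
  then obtain c where "\<And>z. f z = c" by (auto simp: constant_on_def)
  then have "{z \<in> K. f z = 0} = {}" using assms(2) by auto
  then show ?thesis by (metis finite.emptyI)
next
  case False
  then show ?thesis
    by (intro holomorphic_compact_finite_zeros[OF assms(1)]) (use assms(3) in auto)
qed

text \<open>The theorem of Rouche with winding numbers evaluated: they are 1 inside the rectangle and 0
outside, and on the boundary neither function vanishes.\<close>
lemma Rouche_rectangle:
  assumes holo: "f holomorphic_on UNIV" "g holomorphic_on UNIV"
    and ab: "Re a < Re b" "Im a < Im b"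
    and less: "\<And>z. z \<in> cbox a b - box a b \<Longrightarrow> norm (g z) < norm (f z)"
  shows "finite {z \<in> box a b. f z + g z = 0}"
    and "(\<Sum>p\<in>{z \<in> box a b. f z + g z = 0}. zorder (\<lambda>z. f z + g z) p) =
         (\<Sum>p\<in>{z \<in> box a b. f z = 0}. zorder f p)"
proof -
  \<comment> \<open>a bounded neighbourhood of the closed rectangle, so that only finitely many zeros are involved\<close>
  define S where "S = box (a - Complex 1 1) (b + Complex 1 1)"
  have cbox_S: "cbox a b \<subseteq> S"
    by (auto simp: S_def in_cbox_complex_iff in_box_complex_iff)
  have S_cbox: "S \<subseteq> cbox (a - Complex 1 1) (b + Complex 1 1)"
    by (simp add: S_def box_subset_cbox)
  have path: "path_image (rectpath a b) = cbox a b - box a b"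
    using ab by (intro path_image_rectpath_cbox_minus_box) auto
  have a_bdry: "a \<in> cbox a b - box a b"
    using ab by (auto simp: in_cbox_complex_iff in_box_complex_iff)
  have f_nz: "f z \<noteq> 0" and fg_nz: "f z + g z \<noteq> 0" if "z \<in> cbox a b - box a b" for z
    using less[OF that] by (auto simp: add_eq_0_iff)
  have holo_fg: "(\<lambda>z. f z + g z) holomorphic_on UNIV"
    by (intro holomorphic_intros holo)
  have fin: "finite {z \<in> S. h z = 0}" if "h holomorphic_on UNIV" "h a \<noteq> 0" for h :: "complex \<Rightarrow> complex"
    by (rule finite_subset[OF _ finite_zeros_entire[OF that compact_cbox]]) (use S_cbox in auto)
  have fin_f: "finite {z \<in> S. f z = 0}" and fin_fg: "finite {z \<in> S. f z + g z = 0}"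
    using fin[OF holo(1)] fin[OF holo_fg] f_nz[OF a_bdry] fg_nz[OF a_bdry] by auto
  have wind: "(\<Sum>p\<in>{z \<in> S. h z = 0}. winding_number (rectpath a b) p * zorder h p) =
      of_int (\<Sum>p\<in>{z \<in> box a b. h z = 0}. zorder h p)"
    if "finite {z \<in> S. h z = 0}" "\<And>z. z \<in> cbox a b - box a b \<Longrightarrow> h z \<noteq> 0"
    for h :: "complex \<Rightarrow> complex"
  proof -
    have "(\<Sum>p\<in>{z \<in> S. h z = 0}. winding_number (rectpath a b) p * zorder h p) =
        (\<Sum>p\<in>{z \<in> box a b. h z = 0}. winding_number (rectpath a b) p * zorder h p)"
    proof (rule sum.mono_neutral_right)
      show "\<forall>p\<in>{z \<in> S. h z = 0} - {z \<in> box a b. h z = 0}. winding_number (rectpath a b) p * of_int (zorder h p) = 0"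
      proof
        fix p assume "p \<in> {z \<in> S. h z = 0} - {z \<in> box a b. h z = 0}"
        with that(2)[of p] have "p \<notin> cbox a b" by auto
        then have "winding_number (rectpath a b) p = 0"
          using ab by (intro winding_number_rectpath_outside) auto
        then show "winding_number (rectpath a b) p * of_int (zorder h p) = 0" by simp
      qed
    qed (use that(1) cbox_S box_subset_cbox[of a b] in auto)
    also have "\<dots> = (\<Sum>p\<in>{z \<in> box a b. h z = 0}. of_int (zorder h p))"
      by (intro sum.cong refl) (simp add: winding_number_rectpath)
    finally show ?thesis by simp
  qed
  have "(\<Sum>p\<in>{z \<in> S. f z + g z = 0}. winding_number (rectpath a b) p * zorder (\<lambda>z. f z + g z) p) =
      (\<Sum>p\<in>{z \<in> S. f z = 0}. winding_number (rectpath a b) p * zorder f p)"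
  proof (rule Rouche_theorem)
    show "open S" "connected S" by (auto simp: S_def convex_box intro: convex_connected)
    show "f holomorphic_on S" "g holomorphic_on S"
      using holo holomorphic_on_subset by blast+
    show "path_image (rectpath a b) \<subseteq> S" using path cbox_S by auto
    show "\<forall>z\<in>path_image (rectpath a b). norm (g z) < norm (f z)"
      unfolding path using less by blast
    show "\<forall>z. z \<notin> S \<longrightarrow> winding_number (rectpath a b) z = 0"
      using ab cbox_S by (intro allI impI winding_number_rectpath_outside) auto
  qed (use fin_f fin_fg in auto)
  moreover have "(\<Sum>p\<in>{z \<in> S. f z = 0}. winding_number (rectpath a b) p * zorder f p) =
      of_int (\<Sum>p\<in>{z \<in> box a b. f z = 0}. zorder f p)"
    by (rule wind[OF fin_f]) (rule f_nz)
  moreover have "(\<Sum>p\<in>{z \<in> S. f z + g z = 0}. winding_number (rectpath a b) p * zorder (\<lambda>z. f z + g z) p) =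
      of_int (\<Sum>p\<in>{z \<in> box a b. f z + g z = 0}. zorder (\<lambda>z. f z + g z) p)"
    by (rule wind[OF fin_fg]) (rule fg_nz)
  ultimately have "complex_of_int (\<Sum>p\<in>{z \<in> box a b. f z + g z = 0}. zorder (\<lambda>z. f z + g z) p) =
         complex_of_int (\<Sum>p\<in>{z \<in> box a b. f z = 0}. zorder f p)"
    by argo
  then show "(\<Sum>p\<in>{z \<in> box a b. f z + g z = 0}. zorder (\<lambda>z. f z + g z) p) =
         (\<Sum>p\<in>{z \<in> box a b. f z = 0}. zorder f p)"
    unfolding of_int_eq_iff .
  show "finite {z \<in> box a b. f z + g z = 0}"
    by (rule finite_subset[OF _ fin_fg]) (use cbox_S box_subset_cbox[of a b] in auto)
qed

lemma zorder_minus_cos: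
  fixes z :: complex
  assumes "cos z = 0"
  shows "zorder (\<lambda>z. - cos z) z = 1"
proof (rule zorder_zero_eqI[of _ UNIV])
  have deriv: "deriv (\<lambda>z. - cos z) z = sin z"
    by (rule DERIV_imp_deriv) (auto intro!: derivative_eq_intros)
  have "sin z \<noteq> 0" using assms sin_cos_squared_add[of z] by auto
  then show "(deriv ^^ nat 1) (\<lambda>z. - cos z) z \<noteq> 0" using deriv by simp
qed (use assms in \<open>auto intro!: holomorphic_intros\<close>)

lemma norm_cos_eq_cosh:
  assumes "Re z = of_int k * pi"
  shows "norm (cos z) = cosh (Im z)"
proof -
  have "(cos (Re z))\<^sup>2 = 1"
    unfolding assms using cos_npi_int[of k] by (simp add: mult.commute)
  moreover have "(exp (Im z) - inverse (exp (Im z)))\<^sup>2 / 4 = (sinh (Im z))\<^sup>2"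
    by (simp add: sinh_def exp_minus power_divide)
  ultimately have "(norm (cos z))\<^sup>2 = (cosh (Im z))\<^sup>2"
    unfolding norm_cos_squared by (simp add: cosh_square_eq)
  then show ?thesis by (simp add: power2_eq_iff_nonneg)
qed

lemma abs_sinh_le_norm_cos: "\<bar>sinh (Im z)\<bar> \<le> norm (cos z)"
proof -
  have "(exp (Im z) - inverse (exp (Im z)))\<^sup>2 / 4 = (sinh (Im z))\<^sup>2"
    by (simp add: sinh_def exp_minus power_divide)
  then have "(sinh (Im z))\<^sup>2 \<le> (norm (cos z))\<^sup>2"
    unfolding norm_cos_squared by simp
  then show ?thesis by (simp add: abs_le_square_iff[symmetric])
qed

lemma cosh_le_sinh_plus_1: "cosh x \<le> \<bar>sinh x\<bar> + 1" for x :: real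
proof -
  have "cosh \<bar>x\<bar> - sinh \<bar>x\<bar> \<le> 1"
    unfolding cosh_minus_sinh by simp
  then show ?thesis by (cases "x \<ge> 0") auto
qed

text \<open>Moment sequences of probability measures on [0,1] for which the comparison with the cosine is
strict: the last assumption excludes the measures concentrated on [0,\<rho>] together with {1}
for some \<rho> < 1, and with them all measures on finitely many points.\<close>
locale cos_transform_strict =
  fixes s :: "nat \<Rightarrow> real"
  assumes s: "moment_positive s" "s 0 = 1"
    and s1: "s 1 < 1"
    and not_geo: "\<And>\<tau>. 0 \<le> \<tau> \<Longrightarrow> \<tau> < 1 \<Longrightarrow> \<exists>n. \<tau> ^ n < s n - s (Suc n)"
begin

definition cos_gap where "cos_gap z = cos_transform s z - cos z"

lemma less_on_vertical_line:
  assumes "Re z = of_int k * pi" "k \<noteq> 0"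
  shows "norm (cos_transform s z) < norm (cos z)"
proof (cases "Im z = 0")
  case True
  then have z: "z = of_real (of_int k * pi)" using assms(1) by (simp add: complex_eq_iff)
  have "norm (cos_transform s (of_real (of_int k * pi))) < 1"
    using assms(2) by (intro norm_cos_transform_real_less_1[OF s not_geo]) auto
  then show ?thesis
    using norm_cos_eq_cosh[OF assms(1)] True by (simp add: z)
next
  case False
  then have "1 < cosh (Im z)" using cosh_real_ge_1[of "Im z"] cosh_real_one_iff[of "Im z"] by linarith
  then have "s 1 * (cosh (Im z) - 1) < cosh (Im z) - 1"
    using mult_strict_right_mono[OF s1, of "cosh (Im z) - 1"] by simp
  with norm_cos_transform_le[OF s, of z] norm_cos_eq_cosh[OF assms(1)] show ?thesis by linarith
qed

text \<open>Here |cos z| \<ge> |sinh (Im z)| \<ge> cosh (Im z) - 1, so it suffices that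
(1 - s_1)(cosh (Im z) - 1) > 1; the height comes from cosh y > e^y/2 \<ge> (1 + y)/2.\<close>
lemma less_on_horizontal_line:
  assumes "2 + 2 / (1 - s 1) \<le> \<bar>Im z\<bar>"
  shows "norm (cos_transform s z) < norm (cos z)"
proof -
  let ?y = "\<bar>Im z\<bar>"
  have "1 + ?y \<le> exp ?y" by (rule exp_ge_add_one_self)
  moreover have "exp ?y / 2 < cosh ?y" by (simp add: cosh_def)
  moreover have "cosh ?y = cosh (Im z)" by (simp add: cosh_real_abs)
  ultimately have "1 / (1 - s 1) < cosh (Im z) - 1"
    using assms add_divide_distrib[of 1 1 "1 - s 1"] by linarith
  then have "1 < (1 - s 1) * (cosh (Im z) - 1)"
    using s1 by (simp add: pos_divide_less_eq mult.commute)
  with norm_cos_transform_le[OF s, of z] abs_sinh_le_norm_cos[of z] cosh_le_sinh_plus_1[of "Im z"]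
  show ?thesis by (simp add: algebra_simps)
qed

lemma cos_gap_holomorphic: "cos_gap holomorphic_on UNIV"
  unfolding cos_gap_def[abs_def]
  by (intro holomorphic_intros cos_transform_holomorphic moment_positive_abs_le_1[OF s])

lemma cos_gap_0: "cos_gap 0 = 0"
proof -
  have "cos_transform s 0 = of_real (s 0)"
    using powser_zero[of "\<lambda>n. of_real (s n) / fact (2 * n) :: complex"] by (simp add: cos_transform_def)
  then show ?thesis by (simp add: cos_gap_def s(2))
qed

lemma cos_gap_minus: "cos_gap (- z) = cos_gap z"
  by (simp add: cos_gap_def cos_transform_minus)

lemma cos_gap_cnj: "cos_gap (cnj z) = cnj (cos_gap z)"
  using cos_transform_cnj[OF moment_positive_abs_le_1[OF s], where z = z] by (simp add: cos_gap_def cnj_cos)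

lemma cos_gap_nonzero_on_vertical_line:
  assumes "Re z = of_int k * pi" "k \<noteq> 0"
  shows "cos_gap z \<noteq> 0"
  using less_on_vertical_line[OF assms] by (auto simp: cos_gap_def)

lemma zorder_cos_gap_pos:
  assumes "cos_gap z = 0"
  shows "0 < zorder cos_gap z"
proof -
  have "cos_gap (of_real pi) \<noteq> 0"
    by (rule cos_gap_nonzero_on_vertical_line[of _ 1]) auto
  then have "\<forall>\<^sub>F w in at z. cos_gap w \<noteq> 0 \<and> w \<in> UNIV"
    by (intro non_zero_neighbour_alt[OF cos_gap_holomorphic, of z "of_real pi"]) auto
  then have "\<exists>\<^sub>F w in at z. cos_gap w \<noteq> 0"
    by (intro eventually_frequently) (auto elim: eventually_mono)
  with zorder_pos_iff[OF cos_gap_holomorphic, of z] assms show ?thesis by auto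
qed

definition rect where
  "rect m n Y = box (Complex (of_int m * pi) (- Y)) (Complex (of_int n * pi) Y)"

lemma in_rect_iff:
  "z \<in> rect m n Y \<longleftrightarrow> of_int m * pi < Re z \<and> Re z < of_int n * pi \<and> \<bar>Im z\<bar> < Y"
  by (auto simp: rect_def in_box_complex_iff)

lemma cos_zeros_in_rect:
  assumes "0 < Y"
  shows "{z \<in> rect m n Y. cos z = 0} = (\<lambda>k. of_real ((of_int k + 1 / 2) * pi)) ` {m..<n}"
proof (intro equalityI subsetI)
  fix z assume z: "z \<in> {z \<in> rect m n Y. cos z = 0}"
  then obtain k :: int where k: "z = of_real (of_int k * pi) + of_real pi / 2"
    by (auto simp: cos_eq_0)
  have Re_z: "Re z = (of_int k + 1 / 2) * pi" by (simp add: k algebra_simps)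
  have "of_int m < of_int k + (1 / 2 :: real)" "of_int k + (1 / 2 :: real) < of_int n"
    using z Re_z by (simp_all add: in_rect_iff)
  then have "m \<le> k" "k < n" by linarith+
  moreover have "z = of_real ((of_int k + 1 / 2) * pi)" by (simp add: k algebra_simps)
  ultimately show "z \<in> (\<lambda>k. of_real ((of_int k + 1 / 2) * pi)) ` {m..<n}" by auto
next
  fix z assume "z \<in> (\<lambda>k. complex_of_real ((of_int k + 1 / 2) * pi)) ` {m..<n}"
  then obtain k where k: "m \<le> k" "k < n" "z = of_real ((of_int k + 1 / 2) * pi)" by auto
  have "z = of_real (of_int k * pi) + of_real pi / 2" by (simp add: k algebra_simps)
  then have "cos z = 0" unfolding cos_eq_0 by blast
  moreover have "of_int m < of_int k + (1 / 2 :: real)" "of_int k + (1 / 2 :: real) < of_int n"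
    using k(1,2) by linarith+
  then have "z \<in> rect m n Y"
    unfolding in_rect_iff k(3) Re_complex_of_real Im_complex_of_real using assms
    by (intro conjI mult_strict_right_mono) auto
  ultimately show "z \<in> {z \<in> rect m n Y. cos z = 0}" by simp
qed

text \<open>On the boundary of the rectangle the cosine dominates, and the zeros of the cosine inside it are the
n - m numbers (k + 1/2)\<pi> with m \<le> k < n, all simple.\<close>
lemma zero_count:
  assumes mn: "m \<noteq> 0" "n \<noteq> 0" "m < n" and Y: "2 + 2 / (1 - s 1) \<le> Y"
  shows "finite {z \<in> rect m n Y. cos_gap z = 0}"
    and "(\<Sum>p\<in>{z \<in> rect m n Y. cos_gap z = 0}. zorder cos_gap p) = n - m"
proof -
  let ?a = "Complex (of_int m * pi) (- Y)" and ?b = "Complex (of_int n * pi) Y"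
  have "0 < 2 + 2 / (1 - s 1)" using s1 by (intro add_pos_nonneg) auto
  with Y have Y0: "0 < Y" by linarith
  have less: "norm (cos_transform s z) < norm (- cos z)" if "z \<in> cbox ?a ?b - box ?a ?b" for z
  proof -
    from that have "Re z = of_int m * pi \<or> Re z = of_int n * pi \<or> \<bar>Im z\<bar> = Y"
      by (auto simp: in_box_complex_iff in_cbox_complex_iff)
    then show ?thesis
      using less_on_vertical_line[of z m] less_on_vertical_line[of z n] less_on_horizontal_line[of z] mn Y
      by auto
  qed
  have cos_gap_eq: "cos_gap = (\<lambda>z. - cos z + cos_transform s z)" by (auto simp: cos_gap_def)
  have R: "finite {z \<in> rect m n Y. cos_gap z = 0}"
    "(\<Sum>p\<in>{z \<in> rect m n Y. cos_gap z = 0}. zorder cos_gap p) = (\<Sum>p\<in>{z \<in> rect m n Y. - cos z = 0}. zorder (\<lambda>z. - cos z) p)"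
    unfolding cos_gap_eq rect_def
    by (rule Rouche_rectangle; (intro less holomorphic_intros cos_transform_holomorphic moment_positive_abs_le_1[OF s])?;
        use mn Y0 in simp)+
  show "finite {z \<in> rect m n Y. cos_gap z = 0}" by (fact R(1))
  show "(\<Sum>p\<in>{z \<in> rect m n Y. cos_gap z = 0}. zorder cos_gap p) = n - m"
  proof -
    have "(\<Sum>p\<in>{z \<in> rect m n Y. - cos z = 0}. zorder (\<lambda>z. - cos z) p) = (\<Sum>p\<in>{z \<in> rect m n Y. - cos z = 0}. 1)"
      by (rule sum.cong[OF refl], rule zorder_minus_cos) simp
    also have "\<dots> = int (card {z \<in> rect m n Y. cos z = 0})" by simp
    also have "card {z \<in> rect m n Y. cos z = 0} = nat (n - m)"
      unfolding cos_zeros_in_rect[OF Y0] by (subst card_image) (auto simp: inj_on_def)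
    finally show ?thesis unfolding R(2) using mn by simp
  qed
qed

lemma card_zeros_le:
  assumes "finite Z" "\<And>z. z \<in> Z \<Longrightarrow> cos_gap z = 0"
  shows "int (card Z) \<le> (\<Sum>p\<in>Z. zorder cos_gap p)"
proof -
  have "1 \<le> zorder cos_gap p" if "p \<in> Z" for p
    using zorder_cos_gap_pos[OF assms(2)[OF that]] by linarith
  then have "(\<Sum>p\<in>Z. 1) \<le> (\<Sum>p\<in>Z. zorder cos_gap p)"
    by (rule sum_mono)
  then show ?thesis by simp
qed

lemma unique_zero_in_rect:
  assumes "m \<noteq> 0" "m \<noteq> - 1" and Y: "2 + 2 / (1 - s 1) \<le> Y"
  shows "\<exists>p. {z \<in> rect m (m + 1) Y. cos_gap z = 0} = {p} \<and> zorder cos_gap p = 1"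
proof -
  let ?Z = "{z \<in> rect m (m + 1) Y. cos_gap z = 0}"
  have "m + 1 \<noteq> 0" using assms by linarith
  then have fin: "finite ?Z" and sum: "(\<Sum>p\<in>?Z. zorder cos_gap p) = 1"
    using zero_count[of m "m + 1" Y] assms by auto
  have "int (card ?Z) \<le> 1"
    using card_zeros_le[OF fin] sum by simp
  moreover have "?Z \<noteq> {}"
  proof
    assume empty: "?Z = {}"
    show False using sum unfolding empty by simp
  qed
  then have "0 < card ?Z" using fin by (metis card_gt_0_iff)
  ultimately have "card ?Z = 1" by linarith
  then obtain p where p: "?Z = {p}" by (auto simp only: card_1_singleton_iff One_nat_def)
  then have "zorder cos_gap p = 1" using sum unfolding p by simp
  with p show ?thesis by blast
qed

text \<open>Each sufficiently high rectangle over the interval contains one zero; it is real because its complex conjugate lies in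
the same rectangle, and it is the only zero of the strip because any other one would lie in a
higher rectangle together with it.\<close>
lemma unique_zero_in_strip:
  assumes "m \<noteq> 0" "m \<noteq> - 1"
  shows "\<exists>x::real. of_int m * pi < x \<and> x < of_int (m + 1) * pi \<and> cos_gap (of_real x) = 0 \<and>
    zorder cos_gap (of_real x) = 1 \<and>
    (\<forall>z. cos_gap z = 0 \<and> of_int m * pi < Re z \<and> Re z < of_int (m + 1) * pi \<longrightarrow> z = of_real x)"
proof -
  define Y where "Y = 2 + 2 / (1 - s 1)"
  obtain p where p: "{z \<in> rect m (m + 1) Y. cos_gap z = 0} = {p}" "zorder cos_gap p = 1"
    using unique_zero_in_rect[OF assms, of Y] by (auto simp: Y_def)
  have p_rect: "p \<in> rect m (m + 1) Y" "cos_gap p = 0" using p(1) by blast+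
  then have "cnj p \<in> {z \<in> rect m (m + 1) Y. cos_gap z = 0}"
    by (simp add: in_rect_iff cos_gap_cnj)
  then have "cnj p = p" unfolding p(1) by simp
  then have "p \<in> \<real>" by (simp only: Reals_cnj_iff)
  then have p_real: "of_real (Re p) = p" by simp
  have unique: "z = p" if z: "cos_gap z = 0" "of_int m * pi < Re z" "Re z < of_int (m + 1) * pi" for z
  proof -
    define W where "W = max Y (\<bar>Im z\<bar> + 1)"
    have "2 + 2 / (1 - s 1) \<le> W" by (simp add: W_def Y_def)
    from unique_zero_in_rect[OF assms this]
    obtain q where q: "{z \<in> rect m (m + 1) W. cos_gap z = 0} = {q}" by blast
    have "z \<in> {z \<in> rect m (m + 1) W. cos_gap z = 0}"
      using z by (simp add: in_rect_iff W_def)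
    moreover have "p \<in> {z \<in> rect m (m + 1) W. cos_gap z = 0}"
      using p_rect by (simp add: in_rect_iff W_def less_max_iff_disj)
    ultimately show "z = p" unfolding q by simp
  qed
  show ?thesis
  proof (intro exI[of _ "Re p"] conjI allI impI)
    show "of_int m * pi < Re p" "Re p < of_int (m + 1) * pi"
      using p_rect(1) unfolding in_rect_iff by blast+
    show "cos_gap (of_real (Re p)) = 0" "zorder cos_gap (of_real (Re p)) = 1"
      unfolding p_real using p_rect(2) p(2) .
    fix z assume "cos_gap z = 0 \<and> of_int m * pi < Re z \<and> Re z < of_int (m + 1) * pi"
    then show "z = of_real (Re p)"
      unfolding p_real by (intro unique; blast)
  qed
qed

text \<open>The strip has room for two zeros, whereas 0, z and -z would be three.\<close>
lemma zero_in_central_strip: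
  assumes z: "cos_gap z = 0" "\<bar>Re z\<bar> < pi"
  shows "z = 0"
proof (rule ccontr)
  assume nz: "z \<noteq> 0"
  let ?Y = "max (2 + 2 / (1 - s 1)) (\<bar>Im z\<bar> + 1)"
  let ?Z = "{z \<in> rect (- 1) 1 ?Y. cos_gap z = 0}"
  have fin: "finite ?Z" and sum: "(\<Sum>p\<in>?Z. zorder cos_gap p) = 2"
    using zero_count[of "- 1" 1 ?Y] by auto
  have "{0, z, - z} \<subseteq> ?Z"
    using z by (auto simp: in_rect_iff cos_gap_0 cos_gap_minus)
  then have "card {0, z, - z} \<le> card ?Z" by (rule card_mono[OF fin])
  moreover have "card {0, z, - z} = 3" using nz by auto
  moreover have "int (card ?Z) \<le> 2" using card_zeros_le[OF fin] sum by simp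
  ultimately show False by linarith
qed

lemma zero_in_some_strip:
  assumes "cos_gap z = 0" "z \<noteq> 0"
  obtains m :: int where "m \<noteq> 0" "m \<noteq> - 1" "of_int m * pi < Re z" "Re z < of_int (m + 1) * pi"
proof (rule that)
  define m where "m = \<lfloor>Re z / pi\<rfloor>"
  have "of_int m \<le> Re z / pi" "Re z / pi < of_int m + 1"
    unfolding m_def by linarith+
  then have m: "of_int m * pi \<le> Re z" "Re z < of_int (m + 1) * pi"
    by (simp_all add: field_simps)
  have far: "pi \<le> \<bar>Re z\<bar>"
    using zero_in_central_strip[OF assms(1)] assms(2) by linarith
  show "m \<noteq> 0" using m far by auto
  then have "of_int m * pi \<noteq> Re z"
    using cos_gap_nonzero_on_vertical_line[of z m] assms(1) by auto
  with m show less: "of_int m * pi < Re z" by linarith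
  show "m \<noteq> - 1" using m less far by auto
  show "Re z < of_int (m + 1) * pi" by (fact m)
qed

end

section \<open>Weak supermajorization\<close>

text \<open>Summation by parts, in the form that \<Sum>i\<le>k. c_i d_i dominates c_k * (\<Sum>i\<le>k. d_i).\<close>
lemma abel_sum_nonneg:
  fixes c d :: "nat \<Rightarrow> real"
  assumes nonneg: "\<And>i. i < p \<Longrightarrow> 0 \<le> c i"
    and anti: "\<And>i. Suc i < p \<Longrightarrow> c (Suc i) \<le> c i"
    and partial: "\<And>k. k \<le> p \<Longrightarrow> 0 \<le> (\<Sum>i<k. d i)"
  shows "0 \<le> (\<Sum>i<p. c i * d i)"
proof (cases p)
  case (Suc q)
  have "c k * (\<Sum>i<Suc k. d i) \<le> (\<Sum>i<Suc k. c i * d i)" if "k \<le> q" for k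
    using that
  proof (induction k)
    case (Suc k)
    have "c (Suc k) * (\<Sum>i<Suc k. d i) \<le> c k * (\<Sum>i<Suc k. d i)"
      using anti[of k] partial[of "Suc k"] Suc.prems \<open>p = Suc q\<close> by (intro mult_right_mono) auto
    also have "\<dots> \<le> (\<Sum>i<Suc k. c i * d i)"
      using Suc by simp
    finally show ?case
      by (simp only: sum.lessThan_Suc[of _ "Suc k"] distrib_left)
  qed simp
  from this[of q] have "c q * (\<Sum>i<p. d i) \<le> (\<Sum>i<p. c i * d i)"
    by (simp only: Suc order_refl)
  moreover have "0 \<le> c q * (\<Sum>i<p. d i)"
    using nonneg[of q] partial[of p] Suc by (intro mult_nonneg_nonneg) auto
  ultimately show ?thesis by linarith
qed simp

text \<open>For fixed t the function x \<mapsto> t^x is convex and decreasing.  Its tangents at the b_i give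
t^(a_i) - t^(b_i) \<ge> c_i (b_i - a_i) with slopes c_i = - t^(b_i) ln t \<ge> 0 which decrease when
the b_i are sorted, and the partial sums of b_i - a_i are nonnegative.\<close>
lemma v_fun_nonneg_if_weak_supermajorized:
  assumes "weak_supermajorized bs as" "0 \<le> t" "t \<le> 1"
  shows "0 \<le> v_fun as bs t"
proof (cases "t = 0")
  case True
  then show ?thesis by (simp add: v_fun_def)
next
  case False
  with assms have t: "0 < t" "t \<le> 1" by auto
  have len: "length bs = length as"
    and le: "\<And>k. k \<in> {1..length as} \<Longrightarrow> (\<Sum>i<k. sort as ! i) \<le> (\<Sum>i<k. sort bs ! i)"
    using assms(1) by (auto simp: weak_supermajorized_def)
  have sum_sort: "(\<Sum>i<length xs. t powr (xs ! i)) = (\<Sum>i<length xs. t powr (sort xs ! i))" for xs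
  proof -
    have "(\<Sum>i<length xs. t powr (ys ! i)) = (\<Sum>x\<in>#mset xs. t powr x)" if "mset ys = mset xs" for ys
    proof -
      have "length ys = length xs" using that by (metis size_mset)
      then have "(\<Sum>i<length xs. t powr (ys ! i)) = sum_list (map (\<lambda>x. t powr x) ys)"
        by (simp add: sum.list_conv_set_nth lessThan_atLeast0)
      also have "\<dots> = (\<Sum>x\<in>#mset ys. t powr x)" by (simp flip: sum_mset_sum_list)
      finally show ?thesis by (simp add: that)
    qed
    from this[of xs] this[of "sort xs"] show ?thesis by simp
  qed
  define c where "c i = - ln t * t powr (sort bs ! i)" for i
  have "0 \<le> (\<Sum>i<length as. c i * (sort bs ! i - sort as ! i))"
  proof (rule abel_sum_nonneg)
    fix i show "0 \<le> c i" unfolding c_def using t by (intro mult_nonneg_nonneg) auto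
  next
    fix i assume "Suc i < length as"
    then have "sort bs ! i \<le> sort bs ! Suc i"
      by (intro sorted_nth_mono) (simp_all add: len)
    then have "t powr (sort bs ! Suc i) \<le> t powr (sort bs ! i)"
      using t by (intro powr_mono') auto
    then show "c (Suc i) \<le> c i"
      unfolding c_def using t by (intro mult_left_mono) auto
  next
    fix k assume "k \<le> length as"
    then show "0 \<le> (\<Sum>i<k. sort bs ! i - sort as ! i)"
      using le[of k] by (cases "k = 0") (auto simp: sum_subtractf)
  qed
  also have "\<dots> \<le> (\<Sum>i<length as. t powr (sort as ! i) - t powr (sort bs ! i))"
  proof (rule sum_mono)
    fix i
    let ?x = "sort as ! i" and ?y = "sort bs ! i"
    have "t powr ?y * (1 + (?x - ?y) * ln t) \<le> t powr ?y * exp ((?x - ?y) * ln t)"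
      by (intro mult_left_mono exp_ge_add_one_self) simp
    also have "\<dots> = t powr ?x"
      using t by (simp add: powr_def algebra_simps flip: exp_add)
    finally show "c i * (?y - ?x) \<le> t powr ?x - t powr ?y"
      by (simp add: c_def algebra_simps)
  qed
  also have "\<dots> = v_fun as bs t"
    using sum_sort[of as] sum_sort[of bs] by (simp add: v_fun_def sum_subtractf len)
  finally show ?thesis .
qed

section \<open>The hypergeometric function\<close>

text \<open>The additional upper parameter 1/2 supplies the factor (1/2)_n in (2n)! = 4^n n! (1/2)_n.\<close>
lemma hypergeo_eq_cos_transform:
  assumes len: "length b = length ahat + 1" and a: "a = ahat @ [1/2]"
  shows "hypergeo (map of_real ahat) (map of_real b) (- (z\<^sup>2 / 4)) = cos_transform (pochhammer_ratio a b) z"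
proof -
  have fold: "foldl (\<lambda>r x. r * pochhammer x n) c (map of_real xs) = c * of_real (\<Prod>i<length xs. pochhammer (xs ! i) n)"
    for c :: complex and xs :: "real list" and n
  proof (induction xs arbitrary: c)
    case (Cons x xs)
    have "(\<Prod>i<length (x # xs). pochhammer ((x # xs) ! i) n) = pochhammer x n * (\<Prod>i<length xs. pochhammer (xs ! i) n)"
      unfolding length_Cons prod.lessThan_Suc_shift by simp
    then show ?case
      using Cons by (simp add: pochhammer_of_real mult.assoc)
  qed simp
  have coeff: "fps_nth (fps_hypergeo (map of_real ahat) (map of_real b) 1) n * (- (z\<^sup>2 / 4)) ^ n =
      of_real (pochhammer_ratio a b n) * (- (z\<^sup>2)) ^ n / fact (2 * n)" for n
  proof -
    have "(\<Prod>i<length ahat. pochhammer (a ! i) n) = (\<Prod>i<length ahat. pochhammer (ahat ! i) n)"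
      by (intro prod.cong refl) (simp add: a nth_append)
    then have num: "(\<Prod>i<length a. pochhammer (a ! i) n) = (\<Prod>i<length ahat. pochhammer (ahat ! i) n) * pochhammer (1 / 2) n"
      by (simp add: a)
    have ratio: "pochhammer_ratio a b n = (\<Prod>i<length ahat. pochhammer (ahat ! i) n) * pochhammer (1 / 2) n
       / (\<Prod>i<length b. pochhammer (b ! i) n)"
      unfolding pochhammer_ratio_def prod_dividef num using len by (simp add: a)
    have pow: "(- (z\<^sup>2 / 4)) ^ n = (- (z\<^sup>2)) ^ n / 2 ^ (2 * n)"
      by (simp add: power_mult flip: power_divide)
    have half: "complex_of_real (pochhammer (1 / 2) n) = pochhammer (1 / 2) n"
      using pochhammer_of_real[of "1/2" n, where 'a = complex] by simp
    have half_nz: "pochhammer (1 / 2 :: complex) n \<noteq> 0"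
      unfolding half[symmetric] of_real_eq_0_iff using pochhammer_pos[of "1/2::real" n] by simp
    show ?thesis
      unfolding fps_hypergeo_nth fold ratio pow fact_double of_real_mult of_real_divide half
      using half_nz by (simp add: divide_simps)
  qed
  show ?thesis
    unfolding hypergeo_def eval_fps_def cos_transform_def coeff ..
qed

theorem theorem3:
  fixes ahat a b :: "real list" and f :: "complex \<Rightarrow> complex"
  assumes len: "length b = length ahat + 1"
    and ahat_pos: "\<forall>x\<in>set ahat. 0 < x"
    and b_pos: "\<forall>x\<in>set b. 0 < x"
    and a_eq: "a = ahat @ [1/2]"
    and f_eq: "f = hypergeo_minus_cos ahat b"
  shows "(weak_supermajorized b a \<longrightarrow> (\<forall>t\<in>{0..1}. v_fun a b t \<ge> 0)) \<and>
    ((\<forall>t\<in>{0..1}. v_fun a b t \<ge> 0) \<and> mset b \<noteq> mset a \<longrightarrow>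
       f 0 = 0 \<and>
       (\<forall>z. f z = 0 \<longrightarrow> z \<in> \<real>) \<and>
       (\<forall>z. f z = 0 \<and> z \<noteq> 0 \<longrightarrow> zorder f z = 1) \<and>
       (\<forall>n::nat. n \<ge> 1 \<longrightarrow>
          (\<exists>!x::real. x \<in> {real n * pi <..< real (n + 1) * pi} \<and> f (of_real x) = 0)) \<and>
       (\<forall>z. f z = 0 \<and> z \<noteq> 0 \<longrightarrow>
          (\<exists>n::nat. n \<ge> 1 \<and> (\<exists>x::real. x \<in> {real n * pi <..< real (n + 1) * pi} \<and>
             f (of_real x) = 0 \<and> (z = of_real x \<or> z = - of_real x)))))"
proof (intro conjI[of "weak_supermajorized b a \<longrightarrow> (\<forall>t\<in>{0..1}. v_fun a b t \<ge> 0)"] impI)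
  assume "weak_supermajorized b a"
  then show "\<forall>t\<in>{0..1}. v_fun a b t \<ge> 0"
    using v_fun_nonneg_if_weak_supermajorized by auto
next
  assume hyp: "(\<forall>t\<in>{0..1}. v_fun a b t \<ge> 0) \<and> mset b \<noteq> mset a"
  have len_ab: "length b = length a" by (simp add: len a_eq)
  have a_nth: "0 < a ! i" if "i < length a" for i
  proof -
    have "\<forall>x\<in>set a. 0 < x" using ahat_pos by (simp add: a_eq)
    with that show ?thesis by (meson nth_mem)
  qed
  have b_nth: "0 < b ! i" if "i < length a" for i
    using b_pos that len_ab by (metis nth_mem)
  have mp: "moment_positive (pochhammer_ratio a b)"
    using hyp a_nth b_nth by (intro moment_positive_pochhammer_ratio) auto
  interpret cos_transform_strict "pochhammer_ratio a b"
  proof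
    show "pochhammer_ratio a b 0 = 1" by (rule pochhammer_ratio_0)
    show "pochhammer_ratio a b 1 < 1"
      using hyp by (intro pochhammer_ratio_1_less_1[OF len_ab a_nth b_nth mp]) auto
    show "\<exists>n. \<tau> ^ n < pochhammer_ratio a b n - pochhammer_ratio a b (Suc n)" if "0 \<le> \<tau>" "\<tau> < 1" for \<tau>
      using hyp that by (intro pochhammer_ratio_not_geometric[OF len_ab a_nth b_nth mp]) auto
  qed (rule mp)
  have f: "f = cos_gap"
    unfolding f_eq hypergeo_minus_cos_def cos_gap_def fun_eq_iff
    using hypergeo_eq_cos_transform[OF len a_eq] by simp
  have located: "\<exists>m x. m \<noteq> 0 \<and> m \<noteq> - 1 \<and> of_int m * pi < x \<and> x < of_int (m + 1) * pi \<and>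
      z = of_real x \<and> zorder cos_gap z = 1" if z: "cos_gap z = 0" "z \<noteq> 0" for z
  proof -
    obtain m :: int where m: "m \<noteq> 0" "m \<noteq> - 1" "of_int m * pi < Re z" "Re z < of_int (m + 1) * pi"
      using zero_in_some_strip[OF z] .
    from unique_zero_in_strip[OF m(1,2)] z(1) m show ?thesis by metis
  qed
  show "f 0 = 0 \<and>
       (\<forall>z. f z = 0 \<longrightarrow> z \<in> \<real>) \<and>
       (\<forall>z. f z = 0 \<and> z \<noteq> 0 \<longrightarrow> zorder f z = 1) \<and>
       (\<forall>n::nat. n \<ge> 1 \<longrightarrow>
          (\<exists>!x::real. x \<in> {real n * pi <..< real (n + 1) * pi} \<and> f (of_real x) = 0)) \<and>
       (\<forall>z. f z = 0 \<and> z \<noteq> 0 \<longrightarrow>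
          (\<exists>n::nat. n \<ge> 1 \<and> (\<exists>x::real. x \<in> {real n * pi <..< real (n + 1) * pi} \<and>
             f (of_real x) = 0 \<and> (z = of_real x \<or> z = - of_real x))))"
    unfolding f
  proof (intro conjI allI impI)
    show "cos_gap 0 = 0" by (rule cos_gap_0)
  next
    fix z assume "cos_gap z = 0"
    then show "z \<in> \<real>" using located[of z] by (cases "z = 0") auto
  next
    fix z assume "cos_gap z = 0 \<and> z \<noteq> 0"
    then show "zorder cos_gap z = 1" using located[of z] by blast
  next
    fix n :: nat assume "1 \<le> n"
    then have "int n \<noteq> 0" "int n \<noteq> - 1" by auto
    from unique_zero_in_strip[OF this] obtain x :: real
      where x: "real n * pi < x" "x < real (n + 1) * pi" "cos_gap (of_real x) = 0"
        and uniq: "\<forall>z. cos_gap z = 0 \<and> real n * pi < Re z \<and> Re z < real (n + 1) * pi \<longrightarrow> z = of_real x"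
      by (auto simp: add.commute)
    show "\<exists>!x::real. x \<in> {real n * pi <..< real (n + 1) * pi} \<and> cos_gap (of_real x) = 0"
    proof (rule ex1I[of _ x])
      show "x \<in> {real n * pi <..< real (n + 1) * pi} \<and> cos_gap (of_real x) = 0"
        using x by simp
      fix y :: real assume "y \<in> {real n * pi <..< real (n + 1) * pi} \<and> cos_gap (of_real y) = 0"
      then have "complex_of_real y = of_real x"
        using uniq[rule_format, of "of_real y"] by simp
      then show "y = x" by simp
    qed
  next
    fix z assume z: "cos_gap z = 0 \<and> z \<noteq> 0"
    then obtain m x where m: "m \<noteq> 0" "m \<noteq> - 1" "of_int m * pi < x" "x < of_int (m + 1) * pi" "z = of_real x"
      using located by blast
    show "\<exists>n::nat. n \<ge> 1 \<and> (\<exists>x::real. x \<in> {real n * pi <..< real (n + 1) * pi} \<and>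
             cos_gap (of_real x) = 0 \<and> (z = of_real x \<or> z = - of_real x))"
    \<comment> \<open>a zero on the negative axis is reflected: the strip with index \<open>m\<close> becomes the one with index \<open>- m - 1\<close>\<close>
    proof (cases "0 < m")
      case True
      define n where "n = nat m"
      have n: "1 \<le> n" "real_of_int m = real n" "real_of_int (m + 1) = real (n + 1)"
        using True by (auto simp: n_def)
      then have "x \<in> {real n * pi <..< real (n + 1) * pi}"
        using m(3,4) by (simp only: greaterThanLessThan_iff)
      moreover have "cos_gap (of_real x) = 0" using z m(5) by blast
      ultimately show ?thesis using n(1) m(5) by blast
    next
      case False
      define n where "n = nat (- m - 1)"
      have n: "1 \<le> n" "real_of_int m = - real (n + 1)" "real_of_int (m + 1) = - real n"
        using False m(1,2) by (auto simp: n_def)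
      have "- (real (n + 1) * pi) < x" "x < - (real n * pi)"
        using m(3,4) unfolding n(2,3) mult_minus_left .
      then have "real n * pi < - x" "- x < real (n + 1) * pi" by linarith+
      then have "- x \<in> {real n * pi <..< real (n + 1) * pi}"
        by (simp only: greaterThanLessThan_iff)
      moreover have "cos_gap (of_real (- x)) = 0"
        using z cos_gap_minus[of z] unfolding m(5) by simp
      moreover have "z = - of_real (- x)" unfolding m(5) by simp
      ultimately show ?thesis using n(1) by blast
    qed
  qed
qed

end
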